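(* Let $\mathcal{C}$ be an additive category with an exact structure $\mathcal{D}$. Let $DPEx(\mathcal{C})$ and $DIEx(\mathcal{C})$ be the classes of $\mathcal{D}$-projectively generated and of $\mathcal{D}$-injectively generated exact structures on $\mathcal{C}$, let $DCot(\mathcal{C})$ be the class of $\mathcal{D}$-cotorsion pairs in $\mathcal{C}$, and define $$\Psi:DPEx(\mathcal{C})\to DCot(\mathcal{C}),\quad \Psi(\mathcal{E})=\bigl({}^{\perp_{\mathcal{D}}}Div(\mathcal{D}\textrm{-}\mathcal{E}),\,Div(\mathcal{D}\textrm{-}\mathcal{E})\bigr),$$ $$\Phi:DIEx(\mathcal{C})\to DCot(\mathcal{C}),\quad \Phi(\mathcal{E})=\bigl(Flat(\mathcal{D}\textrm{-}\mathcal{E}),\,Flat(\mathcal{D}\textrm{-}\mathcal{E})^{\perp_{\mathcal{D}}}\bigr).$$ (1) The map $\Psi$ is surjective. More precisely, for every $\mathcal{D}$-cotorsion pair $(\mathcal{A},\mathcal{B})$ in $\mathcal{C}$, $\mathcal{B}=Div(\mathcal{D}\textrm{-}\mathcal{E})$ for the $\mathcal{D}$-projectively generated exact structure $\mathcal{E}=\pi^{-1}_{\mathcal{D}}(\mathcal{A})$ on $\mathcal{C}$. (2) The map $\Phi$ is surjective. More precisely, for every $\mathcal{D}$-cotorsion pair $(\mathcal{A},\mathcal{B})$ in $\mathcal{C}$, $\mathcal{A}=Flat(\mathcal{D}\textrm{-}\mathcal{E})$ for the $\mathcal{D}$-injectively generated exact structure $\mathcal{E}=\iota^{-1}_{\mathcal{D}}(\mathcal{B})$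 on $\mathcal{C}$.
   Context: An exact structure $\mathcal{E}$ on an additive category $\mathcal{C}$ (Quillen, with Keller's axioms) is a distinguished class of kernel-cokernel pairs $X\rightarrowtail Y\twoheadrightarrow Z$, called $\mathcal{E}$-conflations (their kernels are $\mathcal{E}$-inflations, their cokernels $\mathcal{E}$-deflations), such that: $1_0$ is a deflation; deflations are closed under composition; pullbacks of deflations along arbitrary morphisms exist and are deflations; pushouts of inflations along arbitrary morphisms exist and are inflations. $\mathrm{Ext}^1_{\mathcal{D}}(-,-)$ is the Yoneda bifunctor; $\mathrm{Ext}^1_{\mathcal{D}}(Z,X)=0$ iff every $\mathcal{D}$-conflation $X\rightarrowtail Y\twoheadrightarrow Z$ splits. For a class $\mathcal{A}$ of objects, $\mathcal{A}^{\perp_{\mathcal{D}}}=\{X\mid \mathrm{Ext}^1_{\mathcal{D}}(A,X)=0\ \forall A\in\mathcal{A}\}$ and ${}^{\perp_{\mathcal{D}}}\mathcal{A}=\{X\mid \mathrm{Ext}^1_{\mathcal{D}}(X,A)=0\ \forall A\in\mathcal{A}\}$. A $\mathcal{D}$-cotorsion pair is a pair $(\mathcal{A},\mathcal{B})$ of classes of objects with $\mathcal{A}^{\perp_{\mathcal{D}}}=\mathcal{B}$ and ${}^{\perp_{\mathcal{D}}}\mathcal{B}=\mathcal{A}$. For a class $\mathcal{M}$ of objects, $\pi^{-1}_{\mathcal{D}}(\mathcal{M})$ (the exact structure $\mathcal{D}$-projectively generated by $\mathcal{M}$) consists of the $\mathcal{D}$-conflations $X\to Y\to Z$ such that $0\to\mathrm{Hom}(M,X)\to\mathrm{Hom}(M,Y)\to\mathrm{Hom}(M,Z)\to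 0$ is exact in abelian groups for every $M\in\mathcal{M}$; $\iota^{-1}_{\mathcal{D}}(\mathcal{M})$ (the exact structure $\mathcal{D}$-injectively generated by $\mathcal{M}$) consists of the $\mathcal{D}$-conflations $X\to Y\to Z$ such that $0\to\mathrm{Hom}(Z,M)\to\mathrm{Hom}(Y,M)\to\mathrm{Hom}(X,M)\to 0$ is exact for every $M\in\mathcal{M}$. An exact structure is $\mathcal{D}$-projectively (resp. $\mathcal{D}$-injectively) generated if it has the form $\pi^{-1}_{\mathcal{D}}(\mathcal{M})$ (resp. $\iota^{-1}_{\mathcal{D}}(\mathcal{M})$) for some class $\mathcal{M}$. An object $X$ is $\mathcal{D}$-$\mathcal{E}$-divisible if every $\mathcal{D}$-inflation $X\rightarrowtail Y$ is an $\mathcal{E}$-inflation, and $\mathcal{D}$-$\mathcal{E}$-flat if every $\mathcal{D}$-deflation $Y\twoheadrightarrow X$ is an $\mathcal{E}$-deflation; $Div(\mathcal{D}\textrm{-}\mathcal{E})$ and $Flat(\mathcal{D}\textrm{-}\mathcal{E})$ denote the corresponding classes. (The pairs $\Psi(\mathcal{E})$ and $\Phi(\mathcal{E})$ are indeed $\mathcal{D}$-cotorsion pairs.) *)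

theory Defs
  imports "HOL-Algebra.Exact_Sequence"
begin

section \<open>Additive categories\<close>

text \<open>
  A category has a type of (names of) objects, restricted to the carrier \<open>Obj\<close>, and a type of
  morphisms, restricted to the carrier \<open>Mor\<close>. Classes of objects are subsets of \<open>Obj\<close>.
  \<open>g \<cdot> f\<close> is ``first \<open>f\<close>, then \<open>g\<close>''; \<open>Plus\<close> and \<open>Zer\<close> are the addition and the zero morphisms.
  Values of the operations outside the carriers are irrelevant.
\<close>

record ('o, 'm) preadditive_data =
  Obj :: "'o set"
  Mor :: "'m set"
  Dom :: "'m \<Rightarrow> 'o"
  Cod :: "'m \<Rightarrow> 'o"
  Ident :: "'o \<Rightarrow> 'm"
  Comp :: "'m \<Rightarrow> 'm \<Rightarrow> 'm" (infixr \<open>\<cdot>\<index>\<close> 70)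
  Plus :: "'m \<Rightarrow> 'm \<Rightarrow> 'm"
  Zer :: "'o \<Rightarrow> 'o \<Rightarrow> 'm"

definition Hom :: "('o, 'm, 'x) preadditive_data_scheme \<Rightarrow> 'o \<Rightarrow> 'o \<Rightarrow> 'm set"
  where "Hom C X Y = {f \<in> Mor C. Dom C f = X \<and> Cod C f = Y}"

definition Hom_group :: "('o, 'm, 'x) preadditive_data_scheme \<Rightarrow> 'o \<Rightarrow> 'o \<Rightarrow> 'm monoid"
  where "Hom_group C X Y = \<lparr>carrier = Hom C X Y, monoid.mult = Plus C, one = Zer C X Y\<rparr>"

locale category =
  fixes C :: "('o, 'm, 'x) preadditive_data_scheme" (structure)
  assumes Dom_closed: "f \<in> Mor C \<Longrightarrow> Dom C f \<in> Obj C"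
    and Cod_closed: "f \<in> Mor C \<Longrightarrow> Cod C f \<in> Obj C"
    and Ident_closed: "X \<in> Obj C \<Longrightarrow> Ident C X \<in> Hom C X X"
    and Comp_closed: "\<lbrakk>f \<in> Hom C X Y; g \<in> Hom C Y Z\<rbrakk> \<Longrightarrow> g \<cdot> f \<in> Hom C X Z"
    and Comp_assoc: "\<lbrakk>f \<in> Hom C W X; g \<in> Hom C X Y; h \<in> Hom C Y Z\<rbrakk> \<Longrightarrow> (h \<cdot> g) \<cdot> f = h \<cdot> (g \<cdot> f)"
    and Ident_left: "f \<in> Hom C X Y \<Longrightarrow> Ident C Y \<cdot> f = f"
    and Ident_right: "f \<in> Hom C X Y \<Longrightarrow> f \<cdot> Ident C X = f"

locale preadditive_category = category +
  assumes Hom_comm_group: "\<lbrakk>X \<in> Obj C; Y \<in> Obj C\<rbrakk> \<Longrightarrow> comm_group (Hom_group C X Y)"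
    and Comp_Plus_right: "\<lbrakk>f \<in> Hom C X Y; g \<in> Hom C X Y; h \<in> Hom C Y Z\<rbrakk>
      \<Longrightarrow> h \<cdot> Plus C f g = Plus C (h \<cdot> f) (h \<cdot> g)"
    and Comp_Plus_left: "\<lbrakk>f \<in> Hom C X Y; g \<in> Hom C Y Z; h \<in> Hom C Y Z\<rbrakk>
      \<Longrightarrow> Plus C g h \<cdot> f = Plus C (g \<cdot> f) (h \<cdot> f)"

definition zero_object :: "('o, 'm, 'x) preadditive_data_scheme \<Rightarrow> 'o \<Rightarrow> bool"
  where "zero_object C N \<longleftrightarrow> N \<in> Obj C \<and>
    (\<forall>X\<in>Obj C. (\<exists>!f. f \<in> Hom C X N) \<and> (\<exists>!f. f \<in> Hom C N X))"

text \<open>\<open>i, j\<close> are the injections and \<open>p, q\<close> the projections of a biproduct of \<open>X\<close> and \<open>Y\<close>.\<close>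

definition is_biproduct ::
  "('o, 'm, 'x) preadditive_data_scheme \<Rightarrow> 'o \<Rightarrow> 'o \<Rightarrow> 'm \<Rightarrow> 'm \<Rightarrow> 'm \<Rightarrow> 'm \<Rightarrow> bool"
  where "is_biproduct C X Y i j p q \<longleftrightarrow> (\<exists>P\<in>Obj C.
    i \<in> Hom C X P \<and> j \<in> Hom C Y P \<and> p \<in> Hom C P X \<and> q \<in> Hom C P Y \<and>
    p \<cdot>\<^bsub>C\<^esub> i = Ident C X \<and> q \<cdot>\<^bsub>C\<^esub> j = Ident C Y \<and>
    q \<cdot>\<^bsub>C\<^esub> i = Zer C X Y \<and> p \<cdot>\<^bsub>C\<^esub> j = Zer C Y X \<and>
    Plus C (i \<cdot>\<^bsub>C\<^esub> p) (j \<cdot>\<^bsub>C\<^esub> q) = Ident C P)"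

locale additive_category = preadditive_category +
  assumes zero_object_ex: "\<exists>N. zero_object C N"
    and biproduct_ex: "\<lbrakk>X \<in> Obj C; Y \<in> Obj C\<rbrakk> \<Longrightarrow> \<exists>i j p q. is_biproduct C X Y i j p q"


section \<open>Exact structures\<close>

definition is_iso :: "('o, 'm, 'x) preadditive_data_scheme \<Rightarrow> 'm \<Rightarrow> bool"
  where "is_iso C f \<longleftrightarrow> f \<in> Mor C \<and> (\<exists>g \<in> Hom C (Cod C f) (Dom C f).
    g \<cdot>\<^bsub>C\<^esub> f = Ident C (Dom C f) \<and> f \<cdot>\<^bsub>C\<^esub> g = Ident C (Cod C f))"

definition is_kernel :: "('o, 'm, 'x) preadditive_data_scheme \<Rightarrow> 'm \<Rightarrow> 'm \<Rightarrow> bool"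
  where "is_kernel C k f \<longleftrightarrow> k \<in> Mor C \<and> f \<in> Mor C \<and> Cod C k = Dom C f \<and>
    f \<cdot>\<^bsub>C\<^esub> k = Zer C (Dom C k) (Cod C f) \<and>
    (\<forall>g\<in>Mor C. Cod C g = Dom C f \<and> f \<cdot>\<^bsub>C\<^esub> g = Zer C (Dom C g) (Cod C f) \<longrightarrow>
      (\<exists>!h. h \<in> Hom C (Dom C g) (Dom C k) \<and> k \<cdot>\<^bsub>C\<^esub> h = g))"

definition is_cokernel :: "('o, 'm, 'x) preadditive_data_scheme \<Rightarrow> 'm \<Rightarrow> 'm \<Rightarrow> bool"
  where "is_cokernel C c f \<longleftrightarrow> c \<in> Mor C \<and> f \<in> Mor C \<and> Dom C c = Cod C f \<and>
    c \<cdot>\<^bsub>C\<^esub> f = Zer C (Dom C f) (Cod C c) \<and>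
    (\<forall>g\<in>Mor C. Dom C g = Cod C f \<and> g \<cdot>\<^bsub>C\<^esub> f = Zer C (Dom C f) (Cod C g) \<longrightarrow>
      (\<exists>!h. h \<in> Hom C (Cod C c) (Cod C g) \<and> h \<cdot>\<^bsub>C\<^esub> c = g))"

definition is_pullback ::
  "('o, 'm, 'x) preadditive_data_scheme \<Rightarrow> 'm \<Rightarrow> 'm \<Rightarrow> 'm \<Rightarrow> 'm \<Rightarrow> bool"
  where "is_pullback C f g p q \<longleftrightarrow>
    f \<in> Mor C \<and> g \<in> Mor C \<and> p \<in> Mor C \<and> q \<in> Mor C \<and>
    Cod C f = Cod C g \<and> Dom C p = Dom C q \<and> Cod C p = Dom C f \<and> Cod C q = Dom C g \<and>
    f \<cdot>\<^bsub>C\<^esub> p = g \<cdot>\<^bsub>C\<^esub> q \<and>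
    (\<forall>a\<in>Mor C. \<forall>b\<in>Mor C. Dom C a = Dom C b \<and> Cod C a = Dom C f \<and> Cod C b = Dom C g \<and>
      f \<cdot>\<^bsub>C\<^esub> a = g \<cdot>\<^bsub>C\<^esub> b \<longrightarrow>
      (\<exists>!h. h \<in> Hom C (Dom C a) (Dom C p) \<and> p \<cdot>\<^bsub>C\<^esub> h = a \<and> q \<cdot>\<^bsub>C\<^esub> h = b))"

definition is_pushout ::
  "('o, 'm, 'x) preadditive_data_scheme \<Rightarrow> 'm \<Rightarrow> 'm \<Rightarrow> 'm \<Rightarrow> 'm \<Rightarrow> bool"
  where "is_pushout C f g p q \<longleftrightarrow>
    f \<in> Mor C \<and> g \<in> Mor C \<and> p \<in> Mor C \<and> q \<in> Mor C \<and>
    Dom C f = Dom C g \<and> Cod C p = Cod C q \<and> Dom C p = Cod C f \<and> Dom C q = Cod C g \<and>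
    p \<cdot>\<^bsub>C\<^esub> f = q \<cdot>\<^bsub>C\<^esub> g \<and>
    (\<forall>a\<in>Mor C. \<forall>b\<in>Mor C. Cod C a = Cod C b \<and> Dom C a = Cod C f \<and> Dom C b = Cod C g \<and>
      a \<cdot>\<^bsub>C\<^esub> f = b \<cdot>\<^bsub>C\<^esub> g \<longrightarrow>
      (\<exists>!h. h \<in> Hom C (Cod C p) (Cod C a) \<and> h \<cdot>\<^bsub>C\<^esub> p = a \<and> h \<cdot>\<^bsub>C\<^esub> q = b))"

text \<open>
  A sequence \<open>X \<rightarrow> Y \<rightarrow> Z\<close> is represented by its pair of morphisms \<open>(i, d)\<close>, so
  \<open>X = Dom i\<close>, \<open>Y = Cod i = Dom d\<close> and \<open>Z = Cod d\<close>.
\<close>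

definition inflations :: "('m \<times> 'm) set \<Rightarrow> 'm set"
  where "inflations E = fst ` E"

definition deflations :: "('m \<times> 'm) set \<Rightarrow> 'm set"
  where "deflations E = snd ` E"

definition iso_pairs :: "('o, 'm, 'x) preadditive_data_scheme \<Rightarrow> 'm \<times> 'm \<Rightarrow> 'm \<times> 'm \<Rightarrow> bool"
  where "iso_pairs C = (\<lambda>(i, d) (i', d'). \<exists>a b c.
    is_iso C a \<and> is_iso C b \<and> is_iso C c \<and>
    a \<in> Hom C (Dom C i) (Dom C i') \<and> b \<in> Hom C (Cod C i) (Cod C i') \<and>
    c \<in> Hom C (Cod C d) (Cod C d') \<and>
    b \<cdot>\<^bsub>C\<^esub> i = i' \<cdot>\<^bsub>C\<^esub> a \<and> c \<cdot>\<^bsub>C\<^esub> d = d' \<cdot>\<^bsub>C\<^esub> b)"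

text \<open>
  Keller's axioms. Following the usual convention (Quillen, Keller), an exact structure is closed
  under isomorphism of kernel-cokernel pairs.
\<close>

definition exact_structure ::
  "('o, 'm, 'x) preadditive_data_scheme \<Rightarrow> ('m \<times> 'm) set \<Rightarrow> bool"
  where "exact_structure C E \<longleftrightarrow>
    (\<forall>(i, d)\<in>E. is_kernel C i d \<and> is_cokernel C d i) \<and>
    (\<forall>(i, d)\<in>E. \<forall>i'\<in>Mor C. \<forall>d'\<in>Mor C. Cod C i' = Dom C d' \<and> iso_pairs C (i, d) (i', d')
      \<longrightarrow> (i', d') \<in> E) \<and>
    (\<forall>N. zero_object C N \<longrightarrow> Ident C N \<in> deflations E) \<and>
    (\<forall>d\<in>deflations E. \<forall>d'\<in>deflations E. Cod C d = Dom C d' \<longrightarrow> d' \<cdot>\<^bsub>C\<^esub> d \<in> deflations E) \<and>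
    (\<forall>d\<in>deflations E. \<forall>f\<in>Mor C. Cod C f = Cod C d \<longrightarrow>
      (\<exists>p q. is_pullback C d f p q) \<and> (\<forall>p q. is_pullback C d f p q \<longrightarrow> q \<in> deflations E)) \<and>
    (\<forall>i\<in>inflations E. \<forall>f\<in>Mor C. Dom C f = Dom C i \<longrightarrow>
      (\<exists>p q. is_pushout C i f p q) \<and> (\<forall>p q. is_pushout C i f p q \<longrightarrow> q \<in> inflations E))"


section \<open>Yoneda extensions and cotorsion pairs\<close>

definition conflations_between ::
  "('o, 'm, 'x) preadditive_data_scheme \<Rightarrow> ('m \<times> 'm) set \<Rightarrow> 'o \<Rightarrow> 'o \<Rightarrow> ('m \<times> 'm) set"
  where "conflations_between C D Z X = {(i, d) \<in> D. Dom C i = X \<and> Cod C d = Z}"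

definition yoneda_equiv ::
  "('o, 'm, 'x) preadditive_data_scheme \<Rightarrow> ('m \<times> 'm) set \<Rightarrow> 'o \<Rightarrow> 'o \<Rightarrow> (('m \<times> 'm) \<times> ('m \<times> 'm)) set"
  where "yoneda_equiv C D Z X = {((i, d), (i', d')).
    (i, d) \<in> conflations_between C D Z X \<and> (i', d') \<in> conflations_between C D Z X \<and>
    (\<exists>h\<in>Hom C (Cod C i) (Cod C i'). h \<cdot>\<^bsub>C\<^esub> i = i' \<and> d' \<cdot>\<^bsub>C\<^esub> h = d)}"

text \<open>
  The set of Yoneda classes of extensions of \<open>Z\<close> by \<open>X\<close>, and its zero element, the class of the
  split extensions. The Baer sum is not needed to say that the group \<open>Ext1\<close> vanishes, so it is
  not defined.
\<close>

definition Ext1 ::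
  "('o, 'm, 'x) preadditive_data_scheme \<Rightarrow> ('m \<times> 'm) set \<Rightarrow> 'o \<Rightarrow> 'o \<Rightarrow> ('m \<times> 'm) set set"
  where "Ext1 C D Z X = conflations_between C D Z X // yoneda_equiv C D Z X"

definition splits :: "('o, 'm, 'x) preadditive_data_scheme \<Rightarrow> 'm \<times> 'm \<Rightarrow> bool"
  where "splits C = (\<lambda>(i, d). \<exists>r s. is_biproduct C (Dom C i) (Cod C d) i s r d)"

definition Ext1_zero ::
  "('o, 'm, 'x) preadditive_data_scheme \<Rightarrow> ('m \<times> 'm) set \<Rightarrow> 'o \<Rightarrow> 'o \<Rightarrow> ('m \<times> 'm) set"
  where "Ext1_zero C D Z X = {e \<in> conflations_between C D Z X. splits C e}"

definition Ext1_vanishes ::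
  "('o, 'm, 'x) preadditive_data_scheme \<Rightarrow> ('m \<times> 'm) set \<Rightarrow> 'o \<Rightarrow> 'o \<Rightarrow> bool"
  where "Ext1_vanishes C D Z X \<longleftrightarrow> Ext1 C D Z X = {Ext1_zero C D Z X}"

definition right_perp ::
  "('o, 'm, 'x) preadditive_data_scheme \<Rightarrow> ('m \<times> 'm) set \<Rightarrow> 'o set \<Rightarrow> 'o set"
  where "right_perp C D \<A> = {X \<in> Obj C. \<forall>A\<in>\<A>. Ext1_vanishes C D A X}"

definition left_perp ::
  "('o, 'm, 'x) preadditive_data_scheme \<Rightarrow> ('m \<times> 'm) set \<Rightarrow> 'o set \<Rightarrow> 'o set"
  where "left_perp C D \<A> = {X \<in> Obj C. \<forall>A\<in>\<A>. Ext1_vanishes C D X A}"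

definition DCot ::
  "('o, 'm, 'x) preadditive_data_scheme \<Rightarrow> ('m \<times> 'm) set \<Rightarrow> ('o set \<times> 'o set) set"
  where "DCot C D = {(\<A>, \<B>). \<A> \<subseteq> Obj C \<and> \<B> \<subseteq> Obj C \<and>
    right_perp C D \<A> = \<B> \<and> left_perp C D \<B> = \<A>}"


section \<open>Projectively and injectively generated exact structures\<close>

text \<open>
  \<open>short_exact_sequence G3 G2 G1 g f\<close> from the library states that
  \<open>0 \<rightarrow> G1 \<rightarrow> G2 \<rightarrow> G3 \<rightarrow> 0\<close>, with maps \<open>f\<close> and \<open>g\<close>, is exact (note the order of the arguments).
\<close>

definition proj_generated ::
  "('o, 'm, 'x) preadditive_data_scheme \<Rightarrow> ('m \<times> 'm) set \<Rightarrow> 'o set \<Rightarrow> ('m \<times> 'm) set"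
  where "proj_generated C D \<M> = {(i, d) \<in> D. \<forall>M\<in>\<M>.
    short_exact_sequence
      (Hom_group C M (Cod C d)) (Hom_group C M (Cod C i)) (Hom_group C M (Dom C i))
      (\<lambda>f. d \<cdot>\<^bsub>C\<^esub> f) (\<lambda>f. i \<cdot>\<^bsub>C\<^esub> f)}"

definition inj_generated ::
  "('o, 'm, 'x) preadditive_data_scheme \<Rightarrow> ('m \<times> 'm) set \<Rightarrow> 'o set \<Rightarrow> ('m \<times> 'm) set"
  where "inj_generated C D \<M> = {(i, d) \<in> D. \<forall>M\<in>\<M>.
    short_exact_sequence
      (Hom_group C (Dom C i) M) (Hom_group C (Cod C i) M) (Hom_group C (Cod C d) M)
      (\<lambda>f. f \<cdot>\<^bsub>C\<^esub> i) (\<lambda>f. f \<cdot>\<^bsub>C\<^esub> d)}"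

definition DPEx ::
  "('o, 'm, 'x) preadditive_data_scheme \<Rightarrow> ('m \<times> 'm) set \<Rightarrow> ('m \<times> 'm) set set"
  where "DPEx C D = {E. exact_structure C E \<and> (\<exists>\<M>\<subseteq>Obj C. E = proj_generated C D \<M>)}"

definition DIEx ::
  "('o, 'm, 'x) preadditive_data_scheme \<Rightarrow> ('m \<times> 'm) set \<Rightarrow> ('m \<times> 'm) set set"
  where "DIEx C D = {E. exact_structure C E \<and> (\<exists>\<M>\<subseteq>Obj C. E = inj_generated C D \<M>)}"


section \<open>Divisible and flat objects\<close>

definition Div ::
  "('o, 'm, 'x) preadditive_data_scheme \<Rightarrow> ('m \<times> 'm) set \<Rightarrow> ('m \<times> 'm) set \<Rightarrow> 'o set"
  where "Div C D E = {X \<in> Obj C. \<forall>i\<in>inflations D. Dom C i = X \<longrightarrow> i \<in> inflations E}"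

definition Flat ::
  "('o, 'm, 'x) preadditive_data_scheme \<Rightarrow> ('m \<times> 'm) set \<Rightarrow> ('m \<times> 'm) set \<Rightarrow> 'o set"
  where "Flat C D E = {X \<in> Obj C. \<forall>d\<in>deflations D. Cod C d = X \<longrightarrow> d \<in> deflations E}"

definition Psi ::
  "('o, 'm, 'x) preadditive_data_scheme \<Rightarrow> ('m \<times> 'm) set \<Rightarrow> ('m \<times> 'm) set \<Rightarrow> 'o set \<times> 'o set"
  where "Psi C D E = (left_perp C D (Div C D E), Div C D E)"

definition Phi ::
  "('o, 'm, 'x) preadditive_data_scheme \<Rightarrow> ('m \<times> 'm) set \<Rightarrow> ('m \<times> 'm) set \<Rightarrow> 'o set \<times> 'o set"
  where "Phi C D E = (Flat C D E, right_perp C D (Flat C D E))"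

end

theory Submission
  imports Defs
begin

text \<open>
  For every class \<open>\<M>\<close> of objects, the divisible objects of the exact structure projectively generated
  by \<open>\<M>\<close> are exactly \<open>\<M>\<^sup>\<bottom>\<close>: if \<open>X \<rightarrow> Y \<rightarrow> Z\<close> is a conflation with \<open>X \<in> \<M>\<^sup>\<bottom>\<close>, then its
  pullback along any \<open>M \<rightarrow> Z\<close> with \<open>M \<in> \<M>\<close> splits, so \<open>M \<rightarrow> Z\<close> lifts to \<open>Y\<close>; conversely, lifting the
  identity of \<open>M\<close> splits a conflation \<open>X \<rightarrow> Y \<rightarrow> M\<close>. Dually for flat objects, and what remains is the
  Galois connection between the two orthogonals.
\<close>

section \<open>The opposite category\<close>

text \<open>The flat half is meant to follow from the divisible half in the opposite category. The
  obstacle is that Keller's axioms are not visibly self-dual: they ask deflations to compose, while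
  composition of inflations is a theorem with a longer proof. The locale \<open>pre_exact\<close>
  therefore keeps only axioms that are self-dual or come in dual pairs. Orthogonals, divisible and
  flat objects, and every stability property except two are treated at that level. The two
  exceptions, closure under isomorphism of pairs and composition of deflations, are checked directly
  for both kinds of generated structure; for the injective kind, composition needs an extension
  argument of its own.

  A second obstacle is \<open>Ext1\<close>: its vanishing is an equality between sets of Yoneda
  classes, so a split extension has to be exhibited as a conflation before vanishing can be traded
  for the splitting of all conflations.

  The Galois connection serves to show that \<open>Psi\<close> and \<open>Phi\<close> take values in
  \<open>DCot\<close>; that every cotorsion pair is attained comes straight from the two
  orthogonality formulas.\<close>

text \<open>Objects, morphisms, identities and addition are shared with \<open>C\<close>, so
  hom-groups of the opposite category are equal to those of \<open>C\<close>, not merely isomorphic,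
  and dual statements can be obtained by simplification.\<close>

definition opposite :: "('o, 'm, 'x) preadditive_data_scheme \<Rightarrow> ('o, 'm) preadditive_data"
  where "opposite C = \<lparr>Obj = Obj C, Mor = Mor C, Dom = Cod C, Cod = Dom C, Ident = Ident C,
    Comp = (\<lambda>g f. f \<cdot>\<^bsub>C\<^esub> g), Plus = Plus C, Zer = (\<lambda>X Y. Zer C Y X)\<rparr>"

lemma opposite_simps [simp]:
  "Obj (opposite C) = Obj C"
  "Mor (opposite C) = Mor C"
  "Dom (opposite C) = Cod C"
  "Cod (opposite C) = Dom C"
  "Ident (opposite C) = Ident C"
  "g \<cdot>\<^bsub>opposite C\<^esub> f = f \<cdot>\<^bsub>C\<^esub> g"
  "Plus (opposite C) = Plus C"
  "Zer (opposite C) X Y = Zer C Y X"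
  by (simp_all add: opposite_def)

lemma Hom_opposite [simp]: "Hom (opposite C) X Y = Hom C Y X"
  by (auto simp: Hom_def)

lemma Hom_group_opposite [simp]: "Hom_group (opposite C) X Y = Hom_group C Y X"
  by (simp add: Hom_group_def)

lemma category_opposite:
  assumes "category C"
  shows "category (opposite C)"
proof -
  interpret category C by fact
  show ?thesis
    by unfold_locales
      (simp_all add: Dom_closed Cod_closed Ident_closed Comp_closed Comp_assoc Ident_left Ident_right)
qed

lemma preadditive_category_opposite:
  assumes "preadditive_category C"
  shows "preadditive_category (opposite C)"
proof -
  interpret preadditive_category C by fact
  show ?thesis
    by (intro preadditive_category.intro category_opposite category_axioms
        preadditive_category_axioms.intro)
      (simp_all add: Hom_comm_group Comp_Plus_left Comp_Plus_right)
qed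

lemma zero_object_opposite [simp]: "zero_object (opposite C) N \<longleftrightarrow> zero_object C N"
  by (auto simp: zero_object_def)

lemma is_kernel_opposite [simp]: "is_kernel (opposite C) c f \<longleftrightarrow> is_cokernel C c f"
  by (auto simp: is_kernel_def is_cokernel_def)

lemma is_cokernel_opposite [simp]: "is_cokernel (opposite C) k f \<longleftrightarrow> is_kernel C k f"
  by (auto simp: is_kernel_def is_cokernel_def)

lemma is_pullback_opposite [simp]: "is_pullback (opposite C) f g p q \<longleftrightarrow> is_pushout C f g p q"
  unfolding is_pullback_def is_pushout_def by simp

lemma is_pushout_opposite [simp]: "is_pushout (opposite C) f g p q \<longleftrightarrow> is_pullback C f g p q"
  unfolding is_pullback_def is_pushout_def by simp

text \<open>A pair \<open>(i, d)\<close> read in the opposite category is \<open>(d, i)\<close>, so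
  the relational converse \<open>E\<inverse>\<close> is the opposite of a class of
  conflations.\<close>

lemma inflations_converse [simp]: "inflations (E\<inverse>) = deflations E"
  by (force simp: inflations_def deflations_def)

lemma deflations_converse [simp]: "deflations (E\<inverse>) = inflations E"
  by (force simp: inflations_def deflations_def)


section \<open>Additive categories\<close>

context category
begin

lemma HomD:
  assumes "f \<in> Hom C X Y"
  shows "f \<in> Mor C" "Dom C f = X" "Cod C f = Y" "X \<in> Obj C" "Y \<in> Obj C"
  using assms Dom_closed Cod_closed by (auto simp: Hom_def)

lemma MorI: "f \<in> Mor C \<Longrightarrow> f \<in> Hom C (Dom C f) (Cod C f)"
  by (simp add: Hom_def)

lemma is_kernel_iff:
  assumes "i \<in> Hom C X Y" "d \<in> Hom C Y Z"
  shows "is_kernel C i d \<longleftrightarrow> d \<cdot> i = Zer C X Z \<and>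
    (\<forall>T. \<forall>g\<in>Hom C T Y. d \<cdot> g = Zer C T Z \<longrightarrow> (\<exists>!h. h \<in> Hom C T X \<and> i \<cdot> h = g))"
proof -
  \<comment> \<open>Used from right to left: the typed quantifier is turned back into the untyped
    shape of the definition, after which the known domains and codomains rewrite one side into the
    other.\<close>
  have *: "(\<forall>g\<in>Mor C. Cod C g = Y \<and> E (Dom C g) g \<longrightarrow> Q (Dom C g) g) \<longleftrightarrow>
      (\<forall>T. \<forall>g\<in>Hom C T Y. E T g \<longrightarrow> Q T g)" for E Q
    by (auto simp: Hom_def)
  show ?thesis
    unfolding is_kernel_def *[symmetric]
    by (simp only: HomD(1-3)[OF assms(1)] HomD(1-3)[OF assms(2)] simp_thms)
qed

lemma is_pullback_iff:
  assumes "d \<in> Hom C Y Z" "f \<in> Hom C W Z" "p \<in> Hom C P Y" "q \<in> Hom C P W"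
  shows "is_pullback C d f p q \<longleftrightarrow> d \<cdot> p = f \<cdot> q \<and>
    (\<forall>T. \<forall>a\<in>Hom C T Y. \<forall>b\<in>Hom C T W. d \<cdot> a = f \<cdot> b \<longrightarrow>
      (\<exists>!h. h \<in> Hom C T P \<and> p \<cdot> h = a \<and> q \<cdot> h = b))"
proof -
  have *: "(\<forall>a\<in>Mor C. \<forall>b\<in>Mor C. Dom C a = Dom C b \<and> Cod C a = Y \<and> Cod C b = W \<and> E a b
      \<longrightarrow> Q (Dom C a) a b) \<longleftrightarrow> (\<forall>T. \<forall>a\<in>Hom C T Y. \<forall>b\<in>Hom C T W. E a b \<longrightarrow> Q T a b)"
    (is "?l \<longleftrightarrow> ?r") for E Q
  proof
    show ?r if l: ?l
    proof (intro allI ballI impI)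
      fix T a b
      assume ab: "a \<in> Hom C T Y" "b \<in> Hom C T W" "E a b"
      show "Q T a b"
        using l[rule_format, of a b] HomD(1-3)[OF ab(1)] HomD(1-3)[OF ab(2)] ab(3) by simp
    qed
    show ?l if r: ?r
    proof (intro ballI impI, elim conjE)
      fix a b
      assume ab: "a \<in> Mor C" "b \<in> Mor C" "Dom C a = Dom C b" "Cod C a = Y" "Cod C b = W" "E a b"
      show "Q (Dom C a) a b"
        using r[rule_format, of a "Dom C a" b] MorI[OF ab(1)] MorI[OF ab(2)] ab(3-6) by simp
    qed
  qed
  show ?thesis
    unfolding is_pullback_def *[symmetric]
    by (simp only: HomD(1-3)[OF assms(1)] HomD(1-3)[OF assms(2)] HomD(1-3)[OF assms(3)]
        HomD(1-3)[OF assms(4)] simp_thms)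
qed

lemma pullback_lift:
  assumes "is_pullback C d f p q" "d \<in> Hom C Y Z" "f \<in> Hom C W Z" "p \<in> Hom C P Y" "q \<in> Hom C P W"
    and "a \<in> Hom C T Y" "b \<in> Hom C T W" "d \<cdot> a = f \<cdot> b"
  obtains h where "h \<in> Hom C T P" "p \<cdot> h = a" "q \<cdot> h = b"
  using assms(1)[unfolded is_pullback_iff[OF assms(2-5)]] assms(6-8) by blast

lemma pullback_eqI:
  assumes "is_pullback C d f p q" "d \<in> Hom C Y Z" "f \<in> Hom C W Z" "p \<in> Hom C P Y" "q \<in> Hom C P W"
    and "h \<in> Hom C T P" "h' \<in> Hom C T P" "p \<cdot> h = p \<cdot> h'" "q \<cdot> h = q \<cdot> h'"
  shows "h = h'"
proof -
  have "d \<cdot> (p \<cdot> h) = f \<cdot> (q \<cdot> h)"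
    using assms(1)[unfolded is_pullback_iff[OF assms(2-5)]] Comp_assoc[OF assms(6,4,2)]
      Comp_assoc[OF assms(6,5,3)] by simp
  then show ?thesis
    using assms(1)[unfolded is_pullback_iff[OF assms(2-5)], THEN conjunct2, rule_format,
        OF Comp_closed[OF assms(6,4)] Comp_closed[OF assms(6,5)]] assms(6-9)
    by auto
qed

lemma kernel_lift:
  assumes "is_kernel C i d" "i \<in> Hom C X Y" "d \<in> Hom C Y Z" "g \<in> Hom C T Y" "d \<cdot> g = Zer C T Z"
  obtains h where "h \<in> Hom C T X" "i \<cdot> h = g"
  using assms(1)[unfolded is_kernel_iff[OF assms(2,3)]] assms(4,5) by blast

lemma is_pushout_iff:
  assumes "i \<in> Hom C X Y" "f \<in> Hom C X W" "p \<in> Hom C Y P" "q \<in> Hom C W P"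
  shows "is_pushout C i f p q \<longleftrightarrow> p \<cdot> i = q \<cdot> f \<and>
    (\<forall>T. \<forall>a\<in>Hom C Y T. \<forall>b\<in>Hom C W T. a \<cdot> i = b \<cdot> f \<longrightarrow>
      (\<exists>!h. h \<in> Hom C P T \<and> h \<cdot> p = a \<and> h \<cdot> q = b))"
  using category.is_pullback_iff[OF category_opposite[OF category_axioms], of i Y X f W p P q] assms
  by simp

lemma is_pullback_Hom:
  assumes "is_pullback C d f p q" "d \<in> Hom C Y Z" "f \<in> Hom C W Z"
  obtains P where "p \<in> Hom C P Y" "q \<in> Hom C P W"
  using assms by (auto simp: is_pullback_def Hom_def)

end

section \<open>Zero morphisms, differences and kernels\<close>

context preadditive_category
begin

lemma Zer_closed:
  assumes "X \<in> Obj C" "Y \<in> Obj C"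
  shows "Zer C X Y \<in> Hom C X Y"
proof -
  interpret comm_group "Hom_group C X Y" by (intro Hom_comm_group assms)
  show ?thesis using one_closed by (simp add: Hom_group_def)
qed

lemma Plus_closed:
  assumes "f \<in> Hom C X Y" "g \<in> Hom C X Y"
  shows "Plus C f g \<in> Hom C X Y"
proof -
  interpret comm_group "Hom_group C X Y" by (intro Hom_comm_group HomD(4,5)[OF assms(1)])
  show ?thesis using m_closed[of f g] assms by (simp_all add: Hom_group_def)
qed

lemma Plus_commute:
  assumes "f \<in> Hom C X Y" "g \<in> Hom C X Y"
  shows "Plus C f g = Plus C g f"
proof -
  interpret comm_group "Hom_group C X Y" by (intro Hom_comm_group HomD(4,5)[OF assms(1)])
  show ?thesis using m_comm[of f g] assms by (simp_all add: Hom_group_def)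
qed

lemma Plus_assoc:
  assumes "f \<in> Hom C X Y" "g \<in> Hom C X Y" "h \<in> Hom C X Y"
  shows "Plus C (Plus C f g) h = Plus C f (Plus C g h)"
proof -
  interpret comm_group "Hom_group C X Y" by (intro Hom_comm_group HomD(4,5)[OF assms(1)])
  show ?thesis using m_assoc[of f g h] assms by (simp_all add: Hom_group_def)
qed

lemma Plus_Zer:
  assumes "f \<in> Hom C X Y"
  shows "Plus C f (Zer C X Y) = f" "Plus C (Zer C X Y) f = f"
proof -
  interpret comm_group "Hom_group C X Y" by (intro Hom_comm_group HomD(4,5)[OF assms(1)])
  show "Plus C f (Zer C X Y) = f" "Plus C (Zer C X Y) f = f" using r_one[of f] l_one[of f] assms by (simp_all add: Hom_group_def)
qed

lemma Plus_cancel_left: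
  assumes "f \<in> Hom C X Y" "g \<in> Hom C X Y" "Plus C f g = f"
  shows "g = Zer C X Y"
proof -
  interpret comm_group "Hom_group C X Y" by (intro Hom_comm_group HomD(4,5)[OF assms(1)])
  show ?thesis using l_cancel_one[of f g] assms by (simp_all add: Hom_group_def)
qed

lemma negative_ex:
  assumes "f \<in> Hom C X Y"
  obtains g where "g \<in> Hom C X Y" "Plus C f g = Zer C X Y"
proof -
  interpret comm_group "Hom_group C X Y" by (intro Hom_comm_group HomD(4,5)[OF assms(1)])
  show thesis using r_inv_ex[of f] assms that by (auto simp: Hom_group_def)
qed

lemma Comp_Zer:
  assumes "h \<in> Hom C Y Z" "X \<in> Obj C"
  shows "h \<cdot> Zer C X Y = Zer C X Z"
proof -
  note z = Zer_closed[OF assms(2) HomD(4)[OF assms(1)]]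
  note hz = Comp_closed[OF z assms(1)]
  \<comment> \<open>Since zero plus zero is zero, distributivity gives
    \<open>h \<cdot> 0 + h \<cdot> 0 = h \<cdot> 0\<close>, and one summand cancels.\<close>
  show ?thesis
    using Plus_cancel_left[OF hz hz] Comp_Plus_right[OF z z assms(1)] Plus_Zer[OF z] by simp
qed

lemma Zer_Comp:
  assumes "h \<in> Hom C Y Z" "W \<in> Obj C"
  shows "Zer C Z W \<cdot> h = Zer C Y W"
  using preadditive_category.Comp_Zer[OF preadditive_category_opposite[OF preadditive_category_axioms],
      of h Z Y W] assms by simp

text \<open>Both maps factor the same morphism, which \<open>d\<close> kills, so uniqueness in the
  universal property applies.\<close>

lemma kernel_mono:
  assumes "is_kernel C i d" "i \<in> Hom C X Y" "d \<in> Hom C Y Z" "h \<in> Hom C T X" "h' \<in> Hom C T X"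
    and "i \<cdot> h = i \<cdot> h'"
  shows "h = h'"
proof -
  have "d \<cdot> (i \<cdot> h) = Zer C T Z"
    using assms(1)[unfolded is_kernel_iff[OF assms(2,3)]] Comp_assoc[OF assms(4,2,3)]
      Zer_Comp[OF assms(4)] HomD[OF assms(3)] by simp
  then show ?thesis
    using assms(1)[unfolded is_kernel_iff[OF assms(2,3)], THEN conjunct2, rule_format,
        OF Comp_closed[OF assms(4,2)]] assms(4-6)
    by auto
qed

text \<open>The signature has no subtraction; \<open>h\<close> plays the role of
  \<open>f - g\<close>.\<close>

lemma difference_ex:
  assumes "f \<in> Hom C X Y" "g \<in> Hom C X Y"
  obtains h where "h \<in> Hom C X Y" "Plus C g h = f"
proof -
  obtain n where n: "n \<in> Hom C X Y" "Plus C g n = Zer C X Y"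
    using negative_ex assms(2) by blast
  show thesis
    using that[OF Plus_closed[OF n(1) assms(1)]] Plus_assoc[OF assms(2) n(1) assms(1)] n(2)
      Plus_Zer(2)[OF assms(1)] by simp
qed

text \<open>Pulling back does not change the kernel object: \<open>k\<close> is the map into
  \<open>P\<close> with components \<open>i\<close> and zero. A map into \<open>P\<close> that
  \<open>q\<close> kills is determined by its component in \<open>Y\<close>, which \<open>d\<close>
  kills, so it factors through \<open>i\<close>.\<close>

lemma pullback_kernel:
  assumes ker: "is_kernel C i d" "i \<in> Hom C X Y" "d \<in> Hom C Y Z"
    and pb: "is_pullback C d f p q" "f \<in> Hom C W Z" "p \<in> Hom C P Y" "q \<in> Hom C P W"
  obtains k where "k \<in> Hom C X P" "p \<cdot> k = i" "is_kernel C k q"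
proof -
  have comm: "d \<cdot> p = f \<cdot> q" using pb(1)[unfolded is_pullback_iff[OF ker(3) pb(2-4)]] by blast
  have obj: "X \<in> Obj C" "W \<in> Obj C" using HomD ker pb by blast+
  have "d \<cdot> i = f \<cdot> Zer C X W"
    using ker(1)[unfolded is_kernel_iff[OF ker(2,3)]] Comp_Zer[OF pb(2) obj(1)] by simp
  then obtain k where k: "k \<in> Hom C X P" "p \<cdot> k = i" "q \<cdot> k = Zer C X W"
    using pullback_lift[OF pb(1) ker(3) pb(2-4) ker(2) Zer_closed[OF obj]] by blast
  have "is_kernel C k q"
    unfolding is_kernel_iff[OF k(1) pb(4)]
  proof (intro conjI allI ballI impI)
    show "q \<cdot> k = Zer C X W" by fact
  next
    fix T g
    assume g: "g \<in> Hom C T P" "q \<cdot> g = Zer C T W"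
    have T: "T \<in> Obj C" using HomD g(1) by blast
    have "d \<cdot> (p \<cdot> g) = Zer C T Z"
      using comm Comp_assoc[OF g(1) pb(3) ker(3)] Comp_assoc[OF g(1) pb(4,2)] g(2)
        Comp_Zer[OF pb(2) T] by simp
    then obtain h where h: "h \<in> Hom C T X" "i \<cdot> h = p \<cdot> g"
      using kernel_lift[OF ker Comp_closed[OF g(1) pb(3)]] by blast
    have "p \<cdot> (k \<cdot> h) = p \<cdot> g" "q \<cdot> (k \<cdot> h) = q \<cdot> g"
      using Comp_assoc[OF h(1) k(1) pb(3)] Comp_assoc[OF h(1) k(1) pb(4)] k h
        Zer_Comp[OF h(1) obj(2)] g(2) by simp_all
    then have "k \<cdot> h = g"
      using pullback_eqI[OF pb(1) ker(3) pb(2-4) Comp_closed[OF h(1) k(1)] g(1)] by blast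
    moreover have "h' = h" if "h' \<in> Hom C T X" "k \<cdot> h' = g" for h'
    proof -
      have "i \<cdot> h' = i \<cdot> h" using Comp_assoc[OF that(1) k(1) pb(3)] that k h by simp
      then show ?thesis using kernel_mono[OF ker that(1) h(1)] by blast
    qed
    ultimately show "\<exists>!h. h \<in> Hom C T X \<and> k \<cdot> h = g" using h(1) by blast
  qed
  with k that show thesis by blast
qed

lemma kernel_unique:
  assumes "is_kernel C i d" "is_kernel C i' d" "i \<in> Hom C X Y" "d \<in> Hom C Y Z" "i' \<in> Hom C X' Y"
  obtains a b where "a \<in> Hom C X X'" "b \<in> Hom C X' X" "i' \<cdot> a = i" "i \<cdot> b = i'"
    "b \<cdot> a = Ident C X" "a \<cdot> b = Ident C X'"
proof -
  have z: "d \<cdot> i = Zer C X Z" "d \<cdot> i' = Zer C X' Z"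
    using assms(1)[unfolded is_kernel_iff[OF assms(3,4)]]
      assms(2)[unfolded is_kernel_iff[OF assms(5,4)]] by blast+
  obtain a where a: "a \<in> Hom C X X'" "i' \<cdot> a = i"
    using kernel_lift[OF assms(2,5,4,3) z(1)] by blast
  obtain b where b: "b \<in> Hom C X' X" "i \<cdot> b = i'"
    using kernel_lift[OF assms(1,3,4,5) z(2)] by blast
  have "i \<cdot> (b \<cdot> a) = i \<cdot> Ident C X" "i' \<cdot> (a \<cdot> b) = i' \<cdot> Ident C X'"
    using Comp_assoc[OF a(1) b(1) assms(3)] Comp_assoc[OF b(1) a(1) assms(5)] a b
      Ident_right[OF assms(3)] Ident_right[OF assms(5)] by simp_all
  then have "b \<cdot> a = Ident C X" "a \<cdot> b = Ident C X'"
    using kernel_mono[OF assms(1,3,4) Comp_closed[OF a(1) b(1)] Ident_closed[OF HomD(4)[OF assms(3)]]]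
      kernel_mono[OF assms(2,5,4) Comp_closed[OF b(1) a(1)] Ident_closed[OF HomD(4)[OF assms(5)]]]
    by blast+
  with a b that show thesis by blast
qed

lemma cokernel_lift:
  assumes "is_cokernel C d i" "i \<in> Hom C X Y" "d \<in> Hom C Y Z" "g \<in> Hom C Y T" "g \<cdot> i = Zer C X T"
  obtains h where "h \<in> Hom C Z T" "h \<cdot> d = g"
  by (rule category.kernel_lift[OF category_opposite[OF category_axioms], of d i Z Y X g T])
    (use assms that in simp_all)

lemma cokernel_unique:
  assumes "is_cokernel C d i" "is_cokernel C d' i" "i \<in> Hom C X Y" "d \<in> Hom C Y Z" "d' \<in> Hom C Y Z'"
  obtains a b where "a \<in> Hom C Z Z'" "b \<in> Hom C Z' Z" "a \<cdot> d = d'" "b \<cdot> d' = d"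
    "b \<cdot> a = Ident C Z" "a \<cdot> b = Ident C Z'"
  by (rule preadditive_category.kernel_unique[OF preadditive_category_opposite[OF preadditive_category_axioms],
        of d i d' Z Y X Z']) (use assms that in simp_all)

end

text \<open>Injections and projections trade places, and so do the two summands, so that the
  splitting data of \<open>(i, d)\<close> become those of \<open>(d, i)\<close>. The sum of the two
  idempotents then appears in reverse order, whence the appeal to commutativity.\<close>

lemma (in preadditive_category) is_biproduct_opposite:
  "is_biproduct (opposite C) Z X d r s i \<longleftrightarrow> is_biproduct C X Z i s r d"
proof -
  have "Plus C (s \<cdot> d) (i \<cdot> r) = Plus C (i \<cdot> r) (s \<cdot> d)"
    if "i \<in> Hom C X P" "r \<in> Hom C P X" "s \<in> Hom C Z P" "d \<in> Hom C P Z" for P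
    using Plus_commute Comp_closed that by blast
  then show ?thesis
    unfolding is_biproduct_def by (intro bex_cong) auto
qed

lemma additive_category_opposite:
  assumes "additive_category C"
  shows "additive_category (opposite C)"
proof -
  interpret additive_category C by fact
  show ?thesis
  proof (intro additive_category.intro preadditive_category_opposite preadditive_category_axioms
      additive_category_axioms.intro)
    show "\<exists>N. zero_object (opposite C) N" using zero_object_ex by simp
    show "\<exists>i j p q. is_biproduct (opposite C) X Y i j p q"
      if "X \<in> Obj (opposite C)" "Y \<in> Obj (opposite C)" for X Y
      using biproduct_ex[of Y X] that is_biproduct_opposite
      by auto
  qed
qed


context category
begin

lemma is_iso_iff:
  assumes "a \<in> Hom C X Y"
  shows "is_iso C a \<longleftrightarrow> (\<exists>b\<in>Hom C Y X. b \<cdot> a = Ident C X \<and> a \<cdot> b = Ident C Y)"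
  using HomD[OF assms] by (simp add: is_iso_def)

lemma is_iso_Ident: "X \<in> Obj C \<Longrightarrow> is_iso C (Ident C X)"
  using is_iso_iff Ident_closed Ident_left by blast

end

section \<open>Splitting, and left exactness of Hom\<close>

context preadditive_category
begin

text \<open>Links the biproduct definition of splitting with lifting problems: a section is a lift
  of the identity. The retraction is recovered because \<open>i\<close> is a kernel of
  \<open>d\<close>.\<close>

lemma splits_iff_section:
  assumes "is_kernel C i d" "i \<in> Hom C X Y" "d \<in> Hom C Y Z"
  shows "splits C (i, d) \<longleftrightarrow> (\<exists>s\<in>Hom C Z Y. d \<cdot> s = Ident C Z)"
proof
  note i = assms(2) and d = assms(3)
  assume "splits C (i, d)"
  then obtain r s where "is_biproduct C X Z i s r d"
    using HomD[OF i] HomD[OF d] by (auto simp: splits_def)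
  then show "\<exists>s\<in>Hom C Z Y. d \<cdot> s = Ident C Z"
    using HomD[OF d] HomD(2) unfolding is_biproduct_def by metis
next
  note i = assms(2) and d = assms(3)
  assume "\<exists>s\<in>Hom C Z Y. d \<cdot> s = Ident C Z"
  then obtain s where s: "s \<in> Hom C Z Y" "d \<cdot> s = Ident C Z" by blast
  have di: "d \<cdot> i = Zer C X Z" using assms(1)[unfolded is_kernel_iff[OF i d]] by blast
  note obj = HomD(4,5)[OF i] HomD(5)[OF d]
  note e = Comp_closed[OF d s(1)]
  \<comment> \<open>\<open>h\<close> is the complementary idempotent \<open>1 - s \<cdot> d\<close>.
    It is killed by \<open>d\<close>, hence equals \<open>i \<cdot> r\<close> for a map
    \<open>r\<close>, which is the desired retraction.\<close>
  obtain h where h: "h \<in> Hom C Y Y" "Plus C (s \<cdot> d) h = Ident C Y"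
    using difference_ex[OF Ident_closed[OF obj(2)] e] by blast
  have "d \<cdot> (s \<cdot> d) = d"
    using Comp_assoc[OF d s(1) d] s(2) Ident_left[OF d] by simp
  then have "Plus C d (d \<cdot> h) = d"
    using Comp_Plus_right[OF e h(1) d] h(2) Ident_right[OF d] by simp
  then have "d \<cdot> h = Zer C Y Z" by (rule Plus_cancel_left[OF d Comp_closed[OF h(1) d]])
  then obtain r where r: "r \<in> Hom C Y X" "i \<cdot> r = h"
    using kernel_lift[OF assms h(1)] by blast
  have "(s \<cdot> d) \<cdot> i = Zer C X Y"
    using Comp_assoc[OF i d s(1)] di Comp_Zer[OF s(1) obj(1)] by simp
  then have "h \<cdot> i = i"
    using Comp_Plus_left[OF i e h(1)] h(2) Ident_left[OF i] Plus_Zer(2)[OF Comp_closed[OF i h(1)]]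
    by simp
  \<comment> \<open>As \<open>i\<close> is monic, the identities for \<open>r \<cdot> i\<close> and
    \<open>r \<cdot> s\<close> are verified after composing with \<open>i\<close>, where
    \<open>i \<cdot> r\<close> is the explicit map \<open>h\<close>.\<close>
  then have "i \<cdot> (r \<cdot> i) = i \<cdot> Ident C X"
    using Comp_assoc[OF i r(1) i] r(2) Ident_right[OF i] by simp
  then have ri: "r \<cdot> i = Ident C X"
    by (rule kernel_mono[OF assms Comp_closed[OF i r(1)] Ident_closed[OF obj(1)]])
  have "(s \<cdot> d) \<cdot> s = s"
    using Comp_assoc[OF s(1) d s(1)] s(2) Ident_right[OF s(1)] by simp
  then have "Plus C s (h \<cdot> s) = s"
    using Comp_Plus_left[OF s(1) e h(1)] h(2) Ident_left[OF s(1)] by simp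
  then have "h \<cdot> s = Zer C Z Y" by (rule Plus_cancel_left[OF s(1) Comp_closed[OF s(1) h(1)]])
  then have "i \<cdot> (r \<cdot> s) = i \<cdot> Zer C Z X"
    using Comp_assoc[OF s(1) r(1) i] r(2) Comp_Zer[OF i obj(3)] by simp
  then have rs: "r \<cdot> s = Zer C Z X"
    by (rule kernel_mono[OF assms Comp_closed[OF s(1) r(1)] Zer_closed[OF obj(3) obj(1)]])
  have "is_biproduct C X Z i s r d"
    unfolding is_biproduct_def
    using i s r(1) d ri rs di obj(2) h(2) r(2) Plus_commute[OF e h(1)] by (intro bexI[of _ Y]) simp_all
  then show "splits C (i, d)"
    using HomD[OF i] HomD[OF d] by (auto simp: splits_def)
qed

lemma splits_opposite: "splits (opposite C) (d, i) \<longleftrightarrow> splits C (i, d)"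
  unfolding splits_def by (simp add: is_biproduct_opposite) blast

text \<open>The functor Hom from \<open>A\<close> is left exact, by the universal property of the
  kernel; surjectivity on the right is thus the whole content of exactness.\<close>

lemma Hom_short_exact_sequence_iff:
  assumes "is_kernel C i d" "i \<in> Hom C X Y" "d \<in> Hom C Y Z" "A \<in> Obj C"
  shows "short_exact_sequence (Hom_group C A Z) (Hom_group C A Y) (Hom_group C A X)
      (\<lambda>f. d \<cdot> f) (\<lambda>f. i \<cdot> f) \<longleftrightarrow> (\<forall>g\<in>Hom C A Z. \<exists>f\<in>Hom C A Y. d \<cdot> f = g)"
proof -
  note i = assms(2) and d = assms(3)
  note obj = HomD(4,5)[OF i] HomD(5)[OF d]
  have grp: "group (Hom_group C A T)" if "T \<in> Obj C" for T
    using Hom_comm_group[OF assms(4) that] by (rule comm_group.axioms(2))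
  have carr: "carrier (Hom_group C A T) = Hom C A T" for T by (simp add: Hom_group_def)
  have hom: "(\<lambda>f. h \<cdot> f) \<in> hom (Hom_group C A T) (Hom_group C A U)" if "h \<in> Hom C T U" for h T U
    using Comp_closed[OF _ that] Comp_Plus_right[OF _ _ that]
    by (intro homI) (simp_all add: Hom_group_def)
  have inj: "inj_on (\<lambda>f. i \<cdot> f) (Hom C A X)"
    using kernel_mono[OF assms(1-3)] by (auto intro: inj_onI)
  have "(\<lambda>f. i \<cdot> f) ` Hom C A X = {f \<in> Hom C A Y. d \<cdot> f = Zer C A Z}"
  proof (intro equalityI subsetI)
    show "g \<in> {f \<in> Hom C A Y. d \<cdot> f = Zer C A Z}" if g: "g \<in> (\<lambda>f. i \<cdot> f) ` Hom C A X" for g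
    proof -
      obtain f where f: "f \<in> Hom C A X" "g = i \<cdot> f" using g by blast
      show ?thesis
        using f Comp_closed[OF f(1) i] Comp_assoc[OF f(1) i d] Zer_Comp[OF f(1) obj(3)]
          assms(1)[unfolded is_kernel_iff[OF i d]] by simp
    qed
    show "g \<in> (\<lambda>f. i \<cdot> f) ` Hom C A X" if "g \<in> {f \<in> Hom C A Y. d \<cdot> f = Zer C A Z}" for g
      using that kernel_lift[OF assms(1-3), of g A] by blast
  qed
  then have "exact_seq ([Hom_group C A Z, Hom_group C A Y, Hom_group C A X], [\<lambda>f. d \<cdot> f, \<lambda>f. i \<cdot> f])"
    using grp obj hom[OF i] hom[OF d]
    by (simp add: group_hom_def group_hom_axioms_def kernel_def carr) (simp add: Hom_group_def)
  moreover have "(\<lambda>f. i \<cdot> f) \<in> mon (Hom_group C A X) (Hom_group C A Y)"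
    using inj hom[OF i] by (simp add: mon_def carr)
  moreover have "(\<lambda>f. d \<cdot> f) \<in> epi (Hom_group C A Y) (Hom_group C A Z)
      \<longleftrightarrow> (\<forall>g\<in>Hom C A Z. \<exists>f\<in>Hom C A Y. d \<cdot> f = g)"
    using hom[OF d] Comp_closed[OF _ d, of _ A]
    by (simp add: epi_def carr set_eq_iff image_iff) metis
  ultimately show ?thesis by (simp add: short_exact_sequence_iff)
qed

end

section \<open>Exact structures without the composition axiom\<close>

text \<open>
  Dropping the closure of deflations under composition makes Keller's axioms self-dual without
  having to prove that inflations compose.
\<close>

locale pre_exact = additive_category +
  fixes E :: "('b \<times> 'b) set"
  assumes conflation_kernel: "(i, d) \<in> E \<Longrightarrow> is_kernel C i d"
    and conflation_cokernel: "(i, d) \<in> E \<Longrightarrow> is_cokernel C d i"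
    and kernel_closed: "\<lbrakk>(i, d) \<in> E; is_kernel C i' d\<rbrakk> \<Longrightarrow> (i', d) \<in> E"
    and cokernel_closed: "\<lbrakk>(i, d) \<in> E; is_cokernel C d' i\<rbrakk> \<Longrightarrow> (i, d') \<in> E"
    and zero_conflation: "zero_object C N \<Longrightarrow> (Ident C N, Ident C N) \<in> E"
    and pullback_ex: "\<lbrakk>d \<in> deflations E; f \<in> Mor C; Cod C f = Cod C d\<rbrakk> \<Longrightarrow> \<exists>p q. is_pullback C d f p q"
    and pullback_deflation: "\<lbrakk>d \<in> deflations E; is_pullback C d f p q\<rbrakk> \<Longrightarrow> q \<in> deflations E"
    and pushout_ex: "\<lbrakk>i \<in> inflations E; f \<in> Mor C; Dom C f = Dom C i\<rbrakk> \<Longrightarrow> \<exists>p q. is_pushout C i f p q"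
    and pushout_inflation: "\<lbrakk>i \<in> inflations E; is_pushout C i f p q\<rbrakk> \<Longrightarrow> q \<in> inflations E"

text \<open>Kernel axioms trade places with cokernel axioms and pullbacks with pushouts. The zero
  axiom speaks of the pair of identities because that pair is its own converse, whereas an identity
  that is a deflation dualises to one that is an inflation.\<close>

lemma pre_exact_axioms_opposite: "pre_exact_axioms (opposite C) (E\<inverse>) \<longleftrightarrow> pre_exact_axioms C E"
  unfolding pre_exact_axioms_def by (simp, intro iffI conjI; elim conjE; (assumption | blast))

lemma pre_exact_opposite: "pre_exact C E \<Longrightarrow> pre_exact (opposite C) (E\<inverse>)"
  by (simp add: pre_exact_def pre_exact_axioms_opposite additive_category_opposite)

lemma pre_exact_oppositeD:
  "\<lbrakk>additive_category C; pre_exact (opposite C) (E\<inverse>)\<rbrakk> \<Longrightarrow> pre_exact C E"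
  by (simp add: pre_exact_def pre_exact_axioms_opposite)

lemma iso_pairsI:
  assumes "is_iso C a" "is_iso C b" "is_iso C c" "a \<in> Hom C (Dom C i) (Dom C i')"
    "b \<in> Hom C (Cod C i) (Cod C i')" "c \<in> Hom C (Cod C d) (Cod C d')"
    "b \<cdot>\<^bsub>C\<^esub> i = i' \<cdot>\<^bsub>C\<^esub> a" "c \<cdot>\<^bsub>C\<^esub> d = d' \<cdot>\<^bsub>C\<^esub> b"
  shows "iso_pairs C (i, d) (i', d')"
  using assms unfolding iso_pairs_def by blast

text \<open>Closure under isomorphism is applied to isomorphisms of pairs that are identities at two
  of the three objects: two kernels of \<open>d\<close>, or two cokernels of \<open>i\<close>,
  differ by a unique isomorphism.\<close>

lemma pre_exact_of_exact_structure:
  assumes "additive_category C" and ex: "exact_structure C D"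
  shows "pre_exact C D"
proof -
  interpret additive_category C by fact
  have ker: "is_kernel C i d" and coker: "is_cokernel C d i" if "(i, d) \<in> D" for i d
    using ex that unfolding exact_structure_def by blast+
  have iso_closed: "(i', d') \<in> D"
    if "(i, d) \<in> D" "i' \<in> Mor C" "d' \<in> Mor C" "Cod C i' = Dom C d'" "iso_pairs C (i, d) (i', d')"
    for i d i' d'
    using ex that unfolding exact_structure_def by blast
  have kernel_closed: "(i', d) \<in> D" if id: "(i, d) \<in> D" and i': "is_kernel C i' d" for i d i'
  proof -
    obtain X Y Z X' where hom: "i \<in> Hom C X Y" "d \<in> Hom C Y Z" "i' \<in> Hom C X' Y"
      using ker[OF id] i' by (auto simp: is_kernel_def Hom_def)
    note YZ = HomD(4,5)[OF hom(2)]
    obtain a b where ab: "a \<in> Hom C X X'" "b \<in> Hom C X' X" "i' \<cdot>\<^bsub>C\<^esub> a = i"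
      "b \<cdot>\<^bsub>C\<^esub> a = Ident C X" "a \<cdot>\<^bsub>C\<^esub> b = Ident C X'"
      using kernel_unique[OF ker[OF id] i' hom] by metis
    have "is_iso C a" using is_iso_iff[OF ab(1)] ab by blast
    then have "iso_pairs C (i, d) (i', d)"
      using ab(1,3) hom(1-3) is_iso_Ident[OF YZ(1)] is_iso_Ident[OF YZ(2)] Ident_closed[OF YZ(1)]
        Ident_closed[OF YZ(2)] HomD(1-3)[OF hom(1)] HomD(1-3)[OF hom(2)] HomD(1-3)[OF hom(3)]
        Ident_left[OF hom(1)] Ident_left[OF hom(2)] Ident_right[OF hom(2)]
      by (intro iso_pairsI[of C a "Ident C Y" "Ident C Z"]) simp_all
    then show ?thesis
      using iso_closed[OF id] HomD[OF hom(2)] HomD[OF hom(3)] by simp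
  qed
  show ?thesis
  proof unfold_locales
    fix i d d'
    assume id: "(i, d) \<in> D" and d': "is_cokernel C d' i"
    obtain X Y Z Z' where hom: "i \<in> Hom C X Y" "d \<in> Hom C Y Z" "d' \<in> Hom C Y Z'"
      using coker[OF id] d' by (auto simp: is_cokernel_def Hom_def)
    note XY = HomD(4,5)[OF hom(1)]
    obtain a b where ab: "a \<in> Hom C Z Z'" "b \<in> Hom C Z' Z" "a \<cdot>\<^bsub>C\<^esub> d = d'"
      "b \<cdot>\<^bsub>C\<^esub> a = Ident C Z" "a \<cdot>\<^bsub>C\<^esub> b = Ident C Z'"
      using cokernel_unique[OF coker[OF id] d' hom] by metis
    have "is_iso C a" using is_iso_iff[OF ab(1)] ab by blast
    then have "iso_pairs C (i, d) (i, d')"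
      using ab(1,3) hom(1-3) is_iso_Ident[OF XY(1)] is_iso_Ident[OF XY(2)] Ident_closed[OF XY(1)]
        Ident_closed[OF XY(2)] HomD(1-3)[OF hom(1)] HomD(1-3)[OF hom(2)] HomD(1-3)[OF hom(3)]
        Ident_left[OF hom(1)] Ident_right[OF hom(1)] Ident_right[OF hom(3)]
      by (intro iso_pairsI[of C "Ident C X" "Ident C Y" a]) simp_all
    then show "(i, d') \<in> D"
      using iso_closed[OF id] HomD[OF hom(1)] HomD[OF hom(3)] by simp
  next
    fix N
    assume N: "zero_object C N"
    then have "Ident C N \<in> deflations D" using ex unfolding exact_structure_def by blast
    then obtain i where i: "(i, Ident C N) \<in> D" by (auto simp: deflations_def)
    have NO: "N \<in> Obj C" using N by (simp add: zero_object_def)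
    note I = Ident_closed[OF NO]
    have uniq: "f = g" if "f \<in> Hom C T N" "g \<in> Hom C T N" for f g T
      using N HomD(4)[OF that(1)] that unfolding zero_object_def by blast
    \<comment> \<open>The axiom supplies only some kernel \<open>i\<close> of the identity of
      \<open>N\<close>. The identity is also a kernel of itself, because all maps into
      \<open>N\<close> agree, so \<open>kernel_closed\<close> replaces \<open>i\<close> by
      it.\<close>
    have "is_kernel C (Ident C N) (Ident C N)"
      unfolding is_kernel_iff[OF I I]
    proof (intro conjI allI ballI impI)
      show "Ident C N \<cdot>\<^bsub>C\<^esub> Ident C N = Zer C N N"
        using uniq Comp_closed[OF I I] Zer_closed[OF NO NO] by blast
      show "\<exists>!h. h \<in> Hom C T N \<and> Ident C N \<cdot>\<^bsub>C\<^esub> h = g" if "g \<in> Hom C T N" for T g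
      proof (rule ex1I[of _ g])
        show "h = g" if "h \<in> Hom C T N \<and> Ident C N \<cdot>\<^bsub>C\<^esub> h = g" for h
          using that Ident_left[of h T N] by simp
      qed (simp add: that Ident_left[OF that])
    qed
    then show "(Ident C N, Ident C N) \<in> D" using kernel_closed[OF i] by blast
  next
    fix d f p q
    assume "d \<in> deflations D" and pb: "is_pullback C d f p q"
    moreover have "f \<in> Mor C" "Cod C f = Cod C d" using pb by (simp_all add: is_pullback_def)
    ultimately show "q \<in> deflations D" using ex unfolding exact_structure_def by blast
  next
    fix i f p q
    assume "i \<in> inflations D" and po: "is_pushout C i f p q"
    moreover have "f \<in> Mor C" "Dom C f = Dom C i" using po by (simp_all add: is_pushout_def)
    ultimately show "q \<in> inflations D" using ex unfolding exact_structure_def by blast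
  next
    show "\<exists>p q. is_pullback C d f p q"
      if "d \<in> deflations D" "f \<in> Mor C" "Cod C f = Cod C d" for d f
      using ex that unfolding exact_structure_def by blast
    show "\<exists>p q. is_pushout C i f p q"
      if "i \<in> inflations D" "f \<in> Mor C" "Dom C f = Dom C i" for i f
      using ex that unfolding exact_structure_def by blast
  qed (fact ker coker kernel_closed)+
qed

context pre_exact
begin

lemma conflation_Hom:
  assumes "(i, d) \<in> E"
  obtains X Y Z where "i \<in> Hom C X Y" "d \<in> Hom C Y Z"
  using conflation_kernel[OF assms] by (auto simp: is_kernel_def Hom_def)

lemma pullback_conflation:
  assumes "(i, d) \<in> E" "i \<in> Hom C X Y" "d \<in> Hom C Y Z"
    and "is_pullback C d f p q" "f \<in> Hom C W Z" "p \<in> Hom C P Y" "q \<in> Hom C P W"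
  obtains k where "k \<in> Hom C X P" "p \<cdot> k = i" "(k, q) \<in> E"
proof -
  obtain k where k: "k \<in> Hom C X P" "p \<cdot> k = i" "is_kernel C k q"
    using pullback_kernel[OF conflation_kernel[OF assms(1)] assms(2-7)] by blast
  have "d \<in> deflations E" using assms(1) by (force simp: deflations_def)
  then have "q \<in> deflations E" using pullback_deflation assms(4) by blast
  then have "(k, q) \<in> E" using kernel_closed k(3) by (auto simp: deflations_def)
  with k that show thesis by blast
qed

lemma pullback_conflation_ex:
  assumes "(i, d) \<in> E" "i \<in> Hom C X Y" "d \<in> Hom C Y Z" "f \<in> Hom C W Z"
  obtains P p q k where "is_pullback C d f p q" "p \<in> Hom C P Y" "q \<in> Hom C P W"
    "k \<in> Hom C X P" "p \<cdot> k = i" "(k, q) \<in> E"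
proof -
  have "d \<in> deflations E" using assms(1) by (force simp: deflations_def)
  then obtain p q where pq: "is_pullback C d f p q"
    using pullback_ex[of d f] HomD[OF assms(3)] HomD[OF assms(4)] by auto
  obtain P where P: "p \<in> Hom C P Y" "q \<in> Hom C P W"
    using is_pullback_Hom[OF pq assms(3,4)] by blast
  show thesis
    using pullback_conflation[OF assms(1-3) pq assms(4) P] that[OF pq P] by blast
qed

lemma pushout_conflation:
  assumes "(i, d) \<in> E" "i \<in> Hom C X Y" "d \<in> Hom C Y Z"
    and "is_pushout C i f p q" "f \<in> Hom C X W" "p \<in> Hom C Y P" "q \<in> Hom C W P"
  obtains k where "k \<in> Hom C P Z" "k \<cdot> p = d" "(q, k) \<in> E"
  by (rule pre_exact.pullback_conflation[OF pre_exact_opposite[OF pre_exact_axioms],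
        of d i Z Y X f p q W P]) (use assms that in simp_all)

section \<open>Split conflations and the vanishing of Ext1\<close>

lemma Ident_inflation:
  assumes "X \<in> Obj C"
  shows "Ident C X \<in> inflations E"
proof -
  obtain N where N: "zero_object C N" using zero_object_ex by blast
  then obtain z where z: "z \<in> Hom C N X" using assms unfolding zero_object_def by blast
  note I = Ident_closed[OF HomD(4)[OF z]] and J = Ident_closed[OF assms]
  \<comment> \<open>The identity of \<open>X\<close> is a pushout of the zero inflation, the
    identity of \<open>N\<close>, along \<open>N \<rightarrow> X\<close>.\<close>
  have "is_pushout C (Ident C N) z z (Ident C X)"
    unfolding is_pushout_iff[OF I z z J]
  proof (intro conjI allI ballI impI)
    show "z \<cdot> Ident C N = Ident C X \<cdot> z"
      using Ident_left[OF z] Ident_right[OF z] by simp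
  next
    fix T a b
    assume a: "a \<in> Hom C N T" and b: "b \<in> Hom C X T" and "a \<cdot> Ident C N = b \<cdot> z"
    then have "a = b \<cdot> z" using Ident_right[OF a] by simp
    moreover have "h = b" if "h \<in> Hom C X T" "h \<cdot> Ident C X = b" for h
      using Ident_right[OF that(1)] that(2) by simp
    ultimately show "\<exists>!h. h \<in> Hom C X T \<and> h \<cdot> z = a \<and> h \<cdot> Ident C X = b"
      using Ident_right[OF b] b by (intro ex1I[of _ b]) simp_all
  qed
  moreover have "Ident C N \<in> inflations E"
    using zero_conflation[OF N] by (force simp: inflations_def)
  ultimately show ?thesis using pushout_inflation by blast
qed

text \<open>If there were no conflation at all, \<open>Ext1\<close> would be the empty set and not
  the singleton of the zero class. The conflation is found by pulling back a cokernel
  \<open>c : X \<rightarrow> W\<close> of the identity along the zero map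
  \<open>Z \<rightarrow> W\<close>.\<close>

lemma conflations_between_nonempty:
  assumes "X \<in> Obj C" "Z \<in> Obj C"
  obtains i d where "(i, d) \<in> conflations_between C E Z X"
proof -
  obtain c where c: "(Ident C X, c) \<in> E"
    using Ident_inflation[OF assms(1)] by (auto simp: inflations_def)
  note I = Ident_closed[OF assms(1)]
  obtain X' Y W where *: "Ident C X \<in> Hom C X' Y" "c \<in> Hom C Y W"
    using conflation_Hom[OF c] .
  then have W: "c \<in> Hom C X W" using HomD(3)[OF I] HomD(3)[OF *(1)] by simp
  note f = Zer_closed[OF assms(2) HomD(5)[OF W]]
  obtain P p q k where "is_pullback C c (Zer C Z W) p q" "p \<in> Hom C P X" "q \<in> Hom C P Z"
    "k \<in> Hom C X P" "p \<cdot> k = Ident C X" and kq: "(k, q) \<in> E"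
    using pullback_conflation_ex[OF c I W f] .
  then have "Dom C k = X" "Cod C q = Z" using HomD(2,3) by blast+
  then show thesis using that[of k q] kq by (simp add: conflations_between_def)
qed

lemma Ext1_vanishes_iff:
  assumes "X \<in> Obj C" "Z \<in> Obj C"
  shows "Ext1_vanishes C E Z X \<longleftrightarrow> (\<forall>e\<in>conflations_between C E Z X. splits C e)"
proof
  assume van: "Ext1_vanishes C E Z X"
  show "\<forall>e\<in>conflations_between C E Z X. splits C e"
  proof
    fix e
    assume e: "e \<in> conflations_between C E Z X"
    obtain i d where id: "e = (i, d)" by fastforce
    have "(i, d) \<in> E" "Dom C i = X" "Cod C d = Z"
      using e unfolding id conflations_between_def by auto
    then obtain Y where hom: "i \<in> Hom C X Y" "d \<in> Hom C Y Z"
      using conflation_kernel by (auto simp: is_kernel_def Hom_def)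
    have "(e, e) \<in> yoneda_equiv C E Z X"
      using e Ident_closed[OF HomD(5)[OF hom(1)]] Ident_left[OF hom(1)] Ident_right[OF hom(2)]
        HomD(3)[OF hom(1)] unfolding id yoneda_equiv_def by auto
    \<comment> \<open>The class of \<open>e\<close> has to be the only element of
      \<open>Ext1\<close>, the zero class; since \<open>e\<close> lies in its own class, it
      splits.\<close>
    moreover have "yoneda_equiv C E Z X `` {e} = Ext1_zero C E Z X"
      using quotientI[OF e, of "yoneda_equiv C E Z X"] van unfolding Ext1_vanishes_def Ext1_def by simp
    ultimately show "splits C e" by (auto simp: Ext1_zero_def)
  qed
next
  assume all: "\<forall>e\<in>conflations_between C E Z X. splits C e"
  have zero: "Ext1_zero C E Z X = conflations_between C E Z X"
    using all by (auto simp: Ext1_zero_def)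
  have "yoneda_equiv C E Z X `` {e} = conflations_between C E Z X"
    if e: "e \<in> conflations_between C E Z X" for e
  proof (intro equalityI subsetI)
    show "e' \<in> conflations_between C E Z X" if "e' \<in> yoneda_equiv C E Z X `` {e}" for e'
      using that by (auto simp: yoneda_equiv_def)
  next
    fix e'
    assume e': "e' \<in> conflations_between C E Z X"
    obtain i d i' d' where id: "e = (i, d)" "e' = (i', d')" by fastforce
    have "splits C (i, d)" "Dom C i = X" "Cod C d = Z"
      using all e unfolding id conflations_between_def by simp_all
    then obtain r s where "is_biproduct C X Z i s r d"
      unfolding splits_def by auto
    then obtain Y where Y: "i \<in> Hom C X Y" "r \<in> Hom C Y X" "d \<in> Hom C Y Z" "r \<cdot> i = Ident C X"
      "d \<cdot> i = Zer C X Z" unfolding is_biproduct_def by blast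
    have "splits C (i', d')" "Dom C i' = X" "Cod C d' = Z"
      using all e' unfolding id conflations_between_def by simp_all
    then obtain r' s' where "is_biproduct C X Z i' s' r' d'"
      unfolding splits_def by auto
    then obtain Y' where Y': "i' \<in> Hom C X Y'" "s' \<in> Hom C Z Y'" "d' \<in> Hom C Y' Z"
      "d' \<cdot> s' = Ident C Z" "d' \<cdot> i' = Zer C X Z" unfolding is_biproduct_def by blast
    \<comment> \<open>The map \<open>i' \<cdot> r + s' \<cdot> d\<close> matches the two
      decompositions of the middle terms, so any two split conflations are Yoneda
      equivalent.\<close>
    note a = Comp_closed[OF Y(2) Y'(1)] and b = Comp_closed[OF Y(3) Y'(2)]
    have "Plus C (i' \<cdot> r) (s' \<cdot> d) \<cdot> i = i'"
      using Comp_Plus_left[OF Y(1) a b] Comp_assoc[OF Y(1,2) Y'(1)] Comp_assoc[OF Y(1,3) Y'(2)]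
        Y(4,5) Ident_right[OF Y'(1)] Comp_Zer[OF Y'(2) assms(1)] Plus_Zer[OF Y'(1)] by simp
    moreover have "d' \<cdot> Plus C (i' \<cdot> r) (s' \<cdot> d) = d"
      using Comp_Plus_right[OF a b Y'(3)] Comp_assoc[OF Y(2) Y'(1,3)] Comp_assoc[OF Y(3) Y'(2,3)]
        Y'(4,5) Ident_left[OF Y(3)] Zer_Comp[OF Y(2) assms(2)] Plus_Zer[OF Y(3)] by simp
    ultimately show "e' \<in> yoneda_equiv C E Z X `` {e}"
      using e e' Plus_closed[OF a b] HomD(3)[OF Y(1)] HomD(3)[OF Y'(1)]
      unfolding id yoneda_equiv_def by auto
  qed
  moreover obtain i d where "(i, d) \<in> conflations_between C E Z X"
    using conflations_between_nonempty[OF assms] by blast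
  ultimately have "(\<Union>e\<in>conflations_between C E Z X. {yoneda_equiv C E Z X `` {e}}) =
      {conflations_between C E Z X}" by auto
  then show "Ext1_vanishes C E Z X"
    unfolding Ext1_vanishes_def Ext1_def quotient_def zero .
qed


lemma exact_structureI:
  assumes iso_closed: "\<And>i d i' d'. \<lbrakk>(i, d) \<in> E; Cod C i' = Dom C d'; iso_pairs C (i, d) (i', d');
      i' \<in> Mor C; d' \<in> Mor C\<rbrakk> \<Longrightarrow> (i', d') \<in> E"
    and comp_closed: "\<And>d d'. \<lbrakk>d \<in> deflations E; d' \<in> deflations E; Cod C d = Dom C d'\<rbrakk>
      \<Longrightarrow> d' \<cdot> d \<in> deflations E"
  shows "exact_structure C E"
proof -
  have "Ident C N \<in> deflations E" if "zero_object C N" for N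
    using zero_conflation[OF that] by (force simp: deflations_def)
  then show ?thesis
    unfolding exact_structure_def
    using conflation_kernel conflation_cokernel iso_closed comp_closed pullback_ex pullback_deflation
      pushout_ex pushout_inflation
    by (intro conjI ballI allI impI) (auto simp only: split_beta prod.collapse)
qed

section \<open>Generated structures without the composition axiom\<close>

lemma proj_generated_iff:
  assumes "\<M> \<subseteq> Obj C"
  shows "(i, d) \<in> proj_generated C E \<M> \<longleftrightarrow> (i, d) \<in> E \<and>
    (\<forall>A\<in>\<M>. \<forall>g\<in>Hom C A (Cod C d). \<exists>f\<in>Hom C A (Dom C d). d \<cdot> f = g)"
proof (cases "(i, d) \<in> E")
  case True
  obtain X Y Z where hom: "i \<in> Hom C X Y" "d \<in> Hom C Y Z" using conflation_Hom[OF True] .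
  have "short_exact_sequence (Hom_group C A Z) (Hom_group C A Y) (Hom_group C A X)
      (\<lambda>f. d \<cdot> f) (\<lambda>f. i \<cdot> f) \<longleftrightarrow> (\<forall>g\<in>Hom C A Z. \<exists>f\<in>Hom C A Y. d \<cdot> f = g)" if "A \<in> \<M>" for A
    using Hom_short_exact_sequence_iff[OF conflation_kernel[OF True] hom] assms that by blast
  then show ?thesis
    using True HomD(2,3)[OF hom(1)] HomD(2,3)[OF hom(2)] by (simp add: proj_generated_def)
qed (simp add: proj_generated_def)

lemma inj_generated_eq_converse:
  "inj_generated C E \<M> = (proj_generated (opposite C) (E\<inverse>) \<M>)\<inverse>"
proof -
  \<comment> \<open>The two definitions reach the middle object differently: as the codomain of
    \<open>i\<close>, and, in the opposite category, as the domain of \<open>d\<close>.\<close>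
  have "Cod C i = Dom C d" if "(i, d) \<in> E" for i d
    using conflation_kernel[OF that] by (simp add: is_kernel_def)
  then show ?thesis by (auto simp: inj_generated_def proj_generated_def)
qed

lemma inj_generated_iff:
  assumes "\<M> \<subseteq> Obj C"
  shows "(i, d) \<in> inj_generated C E \<M> \<longleftrightarrow> (i, d) \<in> E \<and>
    (\<forall>A\<in>\<M>. \<forall>g\<in>Hom C (Dom C i) A. \<exists>f\<in>Hom C (Cod C i) A. f \<cdot> i = g)"
  unfolding inj_generated_eq_converse
  using pre_exact.proj_generated_iff[OF pre_exact_opposite[OF pre_exact_axioms], of \<M> d i] assms
  by simp

lemma proj_generated_lift:
  assumes "\<M> \<subseteq> Obj C" "(i, d) \<in> proj_generated C E \<M>" "d \<in> Hom C Y Z" "A \<in> \<M>" "g \<in> Hom C A Z"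
  obtains f where "f \<in> Hom C A Y" "d \<cdot> f = g"
  using proj_generated_iff[OF assms(1), of i d] HomD(2,3)[OF assms(3)] assms(2,4,5) by auto

lemma inj_generated_extend:
  assumes "\<M> \<subseteq> Obj C" "(i, d) \<in> inj_generated C E \<M>" "i \<in> Hom C X Y" "A \<in> \<M>" "g \<in> Hom C X A"
  obtains f where "f \<in> Hom C Y A" "f \<cdot> i = g"
  using inj_generated_iff[OF assms(1), of i d] HomD(2,3)[OF assms(3)] assms(2,4,5) by auto

text \<open>Kernels, cokernels, pullbacks and pushouts are inherited from \<open>E\<close>; what has
  to be checked is that maps from objects of \<open>\<M>\<close> still lift along the new
  deflation.\<close>

lemma pre_exact_proj_generated:
  assumes M: "\<M> \<subseteq> Obj C"
  shows "pre_exact C (proj_generated C E \<M>)" (is "pre_exact C ?F")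
proof
  note iff = proj_generated_iff[OF M]
  have E: "(i, d) \<in> E" if "(i, d) \<in> ?F" for i d using that iff by blast
  have FI: "(i, d) \<in> ?F" if "(i, d) \<in> E" "d \<in> Hom C Y Z"
    "\<And>A g. \<lbrakk>A \<in> \<M>; g \<in> Hom C A Z\<rbrakk> \<Longrightarrow> \<exists>f\<in>Hom C A Y. d \<cdot> f = g" for i d Y Z
    using that HomD(2,3)[OF that(2)] iff[of i d] by simp
  have defl: "d \<in> deflations E" if "d \<in> deflations ?F" for d
    using that E by (force simp: deflations_def)
  have infl: "i \<in> inflations E" if "i \<in> inflations ?F" for i
    using that E by (force simp: inflations_def)
  show "is_kernel C i d" if "(i, d) \<in> ?F" for i d using conflation_kernel E that by blast
  show "is_cokernel C d i" if "(i, d) \<in> ?F" for i d using conflation_cokernel E that by blast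
  show "(i', d) \<in> ?F" if "(i, d) \<in> ?F" "is_kernel C i' d" for i i' d
    using that kernel_closed iff by blast
  show "(i, d') \<in> ?F" if id: "(i, d) \<in> ?F" and d': "is_cokernel C d' i" for i d d'
  proof -
    obtain X Y Z where hom: "i \<in> Hom C X Y" "d \<in> Hom C Y Z" using conflation_Hom[OF E[OF id]] .
    obtain Z' where Z': "d' \<in> Hom C Y Z'"
      using d' HomD(3)[OF hom(1)] by (auto simp: is_cokernel_def Hom_def)
    obtain a b where ab: "a \<in> Hom C Z Z'" "b \<in> Hom C Z' Z" "a \<cdot> d = d'" "a \<cdot> b = Ident C Z'"
      using cokernel_unique[OF conflation_cokernel[OF E[OF id]] d' hom Z'] .
    show ?thesis
    proof (rule FI[OF cokernel_closed[OF E[OF id] d'] Z'])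
      fix A g
      assume A: "A \<in> \<M>" and g: "g \<in> Hom C A Z'"
      obtain f where f: "f \<in> Hom C A Y" "d \<cdot> f = b \<cdot> g"
        using proj_generated_lift[OF M id hom(2) A Comp_closed[OF g ab(2)]] .
      have "d' \<cdot> f = g"
        using Comp_assoc[OF f(1) hom(2) ab(1)] Comp_assoc[OF g ab(2,1)] ab(3,4) f(2) Ident_left[OF g]
        by simp
      with f(1) show "\<exists>f\<in>Hom C A Y. d' \<cdot> f = g" by blast
    qed
  qed
  show "(Ident C N, Ident C N) \<in> ?F" if N: "zero_object C N" for N
  proof (rule FI[OF zero_conflation[OF N]])
    show "Ident C N \<in> Hom C N N" using N Ident_closed by (simp add: zero_object_def)
    show "\<exists>f\<in>Hom C A N. Ident C N \<cdot> f = g" if "g \<in> Hom C A N" for A g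
      using that Ident_left by blast
  qed
  show "\<exists>p q. is_pullback C d f p q"
    if "d \<in> deflations ?F" "f \<in> Mor C" "Cod C f = Cod C d" for d f
    using pullback_ex defl that by blast
  show "\<exists>p q. is_pushout C i f p q"
    if "i \<in> inflations ?F" "f \<in> Mor C" "Dom C f = Dom C i" for i f
    using pushout_ex infl that by blast
  show "q \<in> deflations ?F" if d: "d \<in> deflations ?F" and pb: "is_pullback C d f p q" for d f p q
  proof -
    obtain i where i: "(i, d) \<in> ?F" using d by (auto simp: deflations_def)
    obtain X Y Z where hom: "i \<in> Hom C X Y" "d \<in> Hom C Y Z" using conflation_Hom[OF E[OF i]] .
    obtain W where f: "f \<in> Hom C W Z"
      using pb HomD(3)[OF hom(2)] by (auto simp: is_pullback_def Hom_def)
    obtain P where P: "p \<in> Hom C P Y" "q \<in> Hom C P W" using is_pullback_Hom[OF pb hom(2) f] .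
    obtain k where k: "(k, q) \<in> E" using pullback_conflation[OF E[OF i] hom pb f P] .
    have "(k, q) \<in> ?F"
    proof (rule FI[OF k P(2)])
      fix A g
      assume A: "A \<in> \<M>" and g: "g \<in> Hom C A W"
      obtain a where a: "a \<in> Hom C A Y" "d \<cdot> a = f \<cdot> g"
        using proj_generated_lift[OF M i hom(2) A Comp_closed[OF g f]] .
      \<comment> \<open>The lift is the map into the pullback with components \<open>a\<close> and
        \<open>g\<close>.\<close>
      show "\<exists>h\<in>Hom C A P. q \<cdot> h = g"
        using pullback_lift[OF pb hom(2) f P a(1) g a(2)] by blast
    qed
    then show ?thesis by (force simp: deflations_def)
  qed
  show "q \<in> inflations ?F" if i: "i \<in> inflations ?F" and po: "is_pushout C i f p q" for i f p q
  proof -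
    obtain d where d: "(i, d) \<in> ?F" using i by (auto simp: inflations_def)
    obtain X Y Z where hom: "i \<in> Hom C X Y" "d \<in> Hom C Y Z" using conflation_Hom[OF E[OF d]] .
    obtain W P where f: "f \<in> Hom C X W" and P: "p \<in> Hom C Y P" "q \<in> Hom C W P"
      using po HomD(2,3)[OF hom(1)] by (auto simp: is_pushout_def Hom_def)
    \<comment> \<open>The pushout keeps the cokernel object \<open>Z\<close>, and
      \<open>k \<cdot> p = d\<close> lets a lift along \<open>d\<close> be pushed forward along
      \<open>p\<close>.\<close>
    obtain k where k: "k \<in> Hom C P Z" "k \<cdot> p = d" "(q, k) \<in> E"
      using pushout_conflation[OF E[OF d] hom po f P] .
    have "(q, k) \<in> ?F"
    proof (rule FI[OF k(3,1)])
      fix A g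
      assume A: "A \<in> \<M>" and g: "g \<in> Hom C A Z"
      obtain a where a: "a \<in> Hom C A Y" "d \<cdot> a = g" 
        using proj_generated_lift[OF M d hom(2) A g] .
      show "\<exists>h\<in>Hom C A P. k \<cdot> h = g"
        using Comp_closed[OF a(1) P(1)] Comp_assoc[OF a(1) P(1) k(1)] k(2) a(2) by auto
    qed
    then show ?thesis by (force simp: inflations_def)
  qed
qed

lemma pre_exact_inj_generated:
  assumes "\<M> \<subseteq> Obj C"
  shows "pre_exact C (inj_generated C E \<M>)"
proof (rule pre_exact_oppositeD)
  show "pre_exact (opposite C) ((inj_generated C E \<M>)\<inverse>)"
    unfolding inj_generated_eq_converse converse_converse
    using pre_exact.pre_exact_proj_generated[OF pre_exact_opposite[OF pre_exact_axioms], of \<M>] assms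
    by simp
qed (fact additive_category_axioms)

section \<open>Divisible and flat objects as orthogonals\<close>

lemma Div_proj_generated:
  assumes M: "\<M> \<subseteq> Obj C"
  shows "Div C E (proj_generated C E \<M>) = right_perp C E \<M>" (is "Div C E ?F = _")
proof (intro equalityI subsetI)
  interpret F: pre_exact C ?F using pre_exact_proj_generated[OF M] .
  fix X
  assume X: "X \<in> Div C E ?F"
  then have XO: "X \<in> Obj C" by (simp add: Div_def)
  have "Ext1_vanishes C E A X" if A: "A \<in> \<M>" for A
  proof -
    have AO: "A \<in> Obj C" using A M by blast
    have "splits C (i, d)" if "(i, d) \<in> conflations_between C E A X" for i d
    proof -
      have id: "(i, d) \<in> E" "Dom C i = X" "Cod C d = A"
        using that by (auto simp: conflations_between_def)
      then have "i \<in> inflations E" by (force simp: inflations_def)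
      then have "i \<in> inflations ?F" using X id(2) by (simp add: Div_def)
      \<comment> \<open>Divisibility only provides some conflation of \<open>?F\<close> starting
        with \<open>i\<close>, perhaps ending in another cokernel \<open>d'\<close>; closure under
        change of cokernel brings back the given \<open>d\<close>.\<close>
      then obtain d' where "(i, d') \<in> ?F" by (auto simp: inflations_def)
      then have F: "(i, d) \<in> ?F" using F.cokernel_closed conflation_cokernel[OF id(1)] by blast
      obtain Y where hom: "i \<in> Hom C X Y" "d \<in> Hom C Y A"
        using conflation_kernel[OF id(1)] id(2,3) by (auto simp: is_kernel_def Hom_def)
      have "\<exists>s\<in>Hom C A Y. d \<cdot> s = Ident C A"
        using F A Ident_closed[OF AO] HomD(2,3)[OF hom(2)] proj_generated_iff[OF M, of i d] by auto
      then show ?thesis using splits_iff_section[OF conflation_kernel[OF id(1)] hom] by blast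
    qed
    then show ?thesis using Ext1_vanishes_iff[OF XO AO] by auto
  qed
  then show "X \<in> right_perp C E \<M>" using XO by (simp add: right_perp_def)
next
  fix X
  assume X: "X \<in> right_perp C E \<M>"
  then have XO: "X \<in> Obj C" by (simp add: right_perp_def)
  have "i \<in> inflations ?F" if i: "i \<in> inflations E" and dom: "Dom C i = X" for i
  proof -
    obtain d where id: "(i, d) \<in> E" using i by (auto simp: inflations_def)
    obtain Y Z where hom: "i \<in> Hom C X Y" "d \<in> Hom C Y Z"
      using conflation_kernel[OF id] dom by (auto simp: is_kernel_def Hom_def)
    have "\<exists>f\<in>Hom C A Y. d \<cdot> f = g" if A: "A \<in> \<M>" and g: "g \<in> Hom C A Z" for A g
    proof -
      obtain P p q k where P: "is_pullback C d g p q" "p \<in> Hom C P Y" "q \<in> Hom C P A"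
        "k \<in> Hom C X P" "(k, q) \<in> E"
        using pullback_conflation_ex[OF id hom g] .
      have "(k, q) \<in> conflations_between C E A X"
        using P(5) HomD(2)[OF P(4)] HomD(3)[OF P(3)] by (simp add: conflations_between_def)
      moreover have "Ext1_vanishes C E A X" using X A by (simp add: right_perp_def)
      ultimately have "splits C (k, q)" using Ext1_vanishes_iff[OF XO HomD(4)[OF g]] by blast
      then obtain s where s: "s \<in> Hom C A P" "q \<cdot> s = Ident C A"
        using splits_iff_section[OF conflation_kernel[OF P(5)] P(4,3)] by blast
      have "d \<cdot> p = g \<cdot> q" using P(1)[unfolded is_pullback_iff[OF hom(2) g P(2,3)]] by blast
      then have "d \<cdot> (p \<cdot> s) = g"
        using Comp_assoc[OF s(1) P(2) hom(2)] Comp_assoc[OF s(1) P(3) g] s(2) Ident_right[OF g] by simp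
      then show ?thesis using Comp_closed[OF s(1) P(2)] by blast
    qed
    then have "(i, d) \<in> ?F"
      using proj_generated_iff[OF M, of i d] id HomD(2,3)[OF hom(2)] by simp
    then show ?thesis by (force simp: inflations_def)
  qed
  then show "X \<in> Div C E ?F" using XO by (simp add: Div_def)
qed

text \<open>Passing to the opposite category reverses the comparison maps of the Yoneda relation, so
  both sides are compared through the splitting of all extensions, which is visibly
  self-dual.\<close>

lemma Ext1_vanishes_opposite:
  assumes "X \<in> Obj C" "Z \<in> Obj C"
  shows "Ext1_vanishes (opposite C) (E\<inverse>) X Z \<longleftrightarrow> Ext1_vanishes C E Z X"
  using Ext1_vanishes_iff[OF assms] assms splits_opposite
    pre_exact.Ext1_vanishes_iff[OF pre_exact_opposite[OF pre_exact_axioms], of Z X]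
  by (auto simp: conflations_between_def)

lemma right_perp_opposite:
  assumes "\<M> \<subseteq> Obj C"
  shows "right_perp (opposite C) (E\<inverse>) \<M> = left_perp C E \<M>"
  using Ext1_vanishes_opposite assms by (auto simp: right_perp_def left_perp_def)

lemma Flat_inj_generated:
  assumes "\<M> \<subseteq> Obj C"
  shows "Flat C E (inj_generated C E \<M>) = left_perp C E \<M>"
proof -
  have "Flat C E (F\<inverse>) = Div (opposite C) (E\<inverse>) F" for F
    by (simp add: Flat_def Div_def)
  then show ?thesis
    unfolding inj_generated_eq_converse right_perp_opposite[OF assms, symmetric]
    using pre_exact.Div_proj_generated[OF pre_exact_opposite[OF pre_exact_axioms], of \<M>] assms
    by simp
qed

end


section \<open>Generated exact structures\<close>

lemma iso_pairs_Hom: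
  assumes "iso_pairs C (i, d) (i', d')" "i \<in> Hom C X Y" "d \<in> Hom C Y Z" "i' \<in> Hom C X' Y'"
    "d' \<in> Hom C Y' Z'" "category C"
  obtains a a' b b' c c' where "a \<in> Hom C X X'" "a' \<in> Hom C X' X" "b \<in> Hom C Y Y'" "b' \<in> Hom C Y' Y"
    "c \<in> Hom C Z Z'" "c' \<in> Hom C Z' Z" "a \<cdot>\<^bsub>C\<^esub> a' = Ident C X'" "b' \<cdot>\<^bsub>C\<^esub> b = Ident C Y"
    "c \<cdot>\<^bsub>C\<^esub> c' = Ident C Z'" "b \<cdot>\<^bsub>C\<^esub> i = i' \<cdot>\<^bsub>C\<^esub> a" "c \<cdot>\<^bsub>C\<^esub> d = d' \<cdot>\<^bsub>C\<^esub> b"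
proof -
  interpret category C by fact
  obtain a b c where abc: "is_iso C a" "is_iso C b" "is_iso C c" "a \<in> Hom C X X'" "b \<in> Hom C Y Y'"
    "c \<in> Hom C Z Z'" "b \<cdot>\<^bsub>C\<^esub> i = i' \<cdot>\<^bsub>C\<^esub> a" "c \<cdot>\<^bsub>C\<^esub> d = d' \<cdot>\<^bsub>C\<^esub> b"
    using assms(1) HomD(2,3)[OF assms(2)] HomD(2,3)[OF assms(3)] HomD(2,3)[OF assms(4)]
      HomD(2,3)[OF assms(5)] unfolding iso_pairs_def by auto
  obtain a' where a': "a' \<in> Hom C X' X" "a \<cdot>\<^bsub>C\<^esub> a' = Ident C X'"
    using abc(1) is_iso_iff[OF abc(4)] by blast
  obtain b' where b': "b' \<in> Hom C Y' Y" "b' \<cdot>\<^bsub>C\<^esub> b = Ident C Y"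
    using abc(2) is_iso_iff[OF abc(5)] by blast
  obtain c' where c': "c' \<in> Hom C Z' Z" "c \<cdot>\<^bsub>C\<^esub> c' = Ident C Z'"
    using abc(3) is_iso_iff[OF abc(6)] by blast
  show thesis by (rule that[OF abc(4) a'(1) abc(5) b'(1) abc(6) c'(1) a'(2) b'(2) c'(2) abc(7,8)])
qed

lemma exact_structure_iso_closed:
  "\<lbrakk>exact_structure C D; (i, d) \<in> D; Cod C i' = Dom C d'; iso_pairs C (i, d) (i', d');
    i' \<in> Mor C; d' \<in> Mor C\<rbrakk> \<Longrightarrow> (i', d') \<in> D"
  unfolding exact_structure_def by blast

lemma exact_structure_deflations_comp:
  "\<lbrakk>exact_structure C D; d \<in> deflations D; d' \<in> deflations D; Cod C d = Dom C d'\<rbrakk>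
    \<Longrightarrow> d' \<cdot>\<^bsub>C\<^esub> d \<in> deflations D"
  unfolding exact_structure_def by blast

lemma exact_structure_proj_generated:
  assumes "additive_category C" and ex: "exact_structure C D" and M: "\<M> \<subseteq> Obj C"
  shows "exact_structure C (proj_generated C D \<M>)" (is "exact_structure C ?F")
proof -
  interpret pre_exact C D using pre_exact_of_exact_structure[OF assms(1,2)] .
  note iff = proj_generated_iff[OF M]
  show ?thesis
  proof (rule pre_exact.exact_structureI[OF pre_exact_proj_generated[OF M]])
    fix i d i' d'
    assume F: "(i, d) \<in> ?F" and Y': "Cod C i' = Dom C d'" and iso: "iso_pairs C (i, d) (i', d')"
      and mor: "i' \<in> Mor C" "d' \<in> Mor C"
    have id: "(i, d) \<in> D" using F iff by blast
    obtain X Y Z where hom: "i \<in> Hom C X Y" "d \<in> Hom C Y Z" using conflation_Hom[OF id] .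
    obtain X' Y' Z' where hom': "i' \<in> Hom C X' Y'" "d' \<in> Hom C Y' Z'" 
      using MorI[OF mor(1)] MorI[OF mor(2), folded Y'] by blast
    obtain a a' b b' c c' where abc: "a \<in> Hom C X X'" "a' \<in> Hom C X' X" "b \<in> Hom C Y Y'"
      "b' \<in> Hom C Y' Y" "c \<in> Hom C Z Z'" "c' \<in> Hom C Z' Z" "a \<cdot>\<^bsub>C\<^esub> a' = Ident C X'"
      "b' \<cdot>\<^bsub>C\<^esub> b = Ident C Y" "c \<cdot>\<^bsub>C\<^esub> c' = Ident C Z'" "b \<cdot>\<^bsub>C\<^esub> i = i' \<cdot>\<^bsub>C\<^esub> a"
      "c \<cdot>\<^bsub>C\<^esub> d = d' \<cdot>\<^bsub>C\<^esub> b"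
      using iso_pairs_Hom[OF iso hom hom' category_axioms] .
    have "\<exists>f\<in>Hom C A Y'. d' \<cdot>\<^bsub>C\<^esub> f = g" if A: "A \<in> \<M>" and g: "g \<in> Hom C A Z'" for A g
    proof -
      obtain f where f: "f \<in> Hom C A Y" "d \<cdot>\<^bsub>C\<^esub> f = c' \<cdot>\<^bsub>C\<^esub> g"
        using proj_generated_lift[OF M F hom(2) A Comp_closed[OF g abc(6)]] .
      \<comment> \<open>The problem is carried to \<open>d\<close> by \<open>c'\<close>, solved
        there, and the lift is carried back by \<open>b\<close>.\<close>
      have "d' \<cdot>\<^bsub>C\<^esub> (b \<cdot>\<^bsub>C\<^esub> f) = g"
        using Comp_assoc[OF f(1) abc(3) hom'(2)] Comp_assoc[OF f(1) hom(2) abc(5)]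
          Comp_assoc[OF g abc(6,5)] abc(9,11) f(2) Ident_left[OF g] by simp
      then show ?thesis using Comp_closed[OF f(1) abc(3)] by blast
    qed
    then show "(i', d') \<in> ?F"
      using iff[of i' d'] exact_structure_iso_closed[OF ex id Y' iso mor] HomD(2,3)[OF hom'(2)] by simp
  next
    fix d d'
    assume "d \<in> deflations ?F" "d' \<in> deflations ?F" and comp: "Cod C d = Dom C d'"
    then obtain i i' where F: "(i, d) \<in> ?F" "(i', d') \<in> ?F" by (auto simp: deflations_def)
    then have D: "(i, d) \<in> D" "(i', d') \<in> D" using iff by blast+
    then have "d' \<cdot>\<^bsub>C\<^esub> d \<in> deflations D"
      using exact_structure_deflations_comp[OF ex _ _ comp] by (force simp: deflations_def)
    then obtain k where k: "(k, d' \<cdot>\<^bsub>C\<^esub> d) \<in> D" by (auto simp: deflations_def)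
    obtain X Y Z where hom: "i \<in> Hom C X Y" "d \<in> Hom C Y Z" using conflation_Hom[OF D(1)] .
    obtain W where d': "d' \<in> Hom C Z W"
      using conflation_kernel[OF D(2)] comp HomD(3)[OF hom(2)] by (auto simp: is_kernel_def Hom_def)
    have "\<exists>f\<in>Hom C A Y. (d' \<cdot>\<^bsub>C\<^esub> d) \<cdot>\<^bsub>C\<^esub> f = g" if A: "A \<in> \<M>" and g: "g \<in> Hom C A W" for A g
    proof -
      \<comment> \<open>A map into \<open>W\<close> is lifted in two stages, first along
        \<open>d'\<close> and then along \<open>d\<close>.\<close>
      obtain g' where g': "g' \<in> Hom C A Z" "d' \<cdot>\<^bsub>C\<^esub> g' = g"
        using proj_generated_lift[OF M F(2) d' A g] .
      obtain f where f: "f \<in> Hom C A Y" "d \<cdot>\<^bsub>C\<^esub> f = g'"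
        using proj_generated_lift[OF M F(1) hom(2) A g'(1)] .
      show ?thesis using f g'(2) Comp_assoc[OF f(1) hom(2) d'] by auto
    qed
    then have "(k, d' \<cdot>\<^bsub>C\<^esub> d) \<in> ?F"
      using iff[of k "d' \<cdot>\<^bsub>C\<^esub> d"] k HomD(2,3)[OF Comp_closed[OF hom(2) d']] by simp
    then show "d' \<cdot>\<^bsub>C\<^esub> d \<in> deflations ?F" by (force simp: deflations_def)
  qed
qed

text \<open>Here the opposite category is of no direct help: composition of deflations for the
  injective kind corresponds to composition of inflations for the projective kind. Instead, maps out
  of the kernel \<open>K\<close> of a composite \<open>d' \<cdot> d\<close> are extended explicitly,
  using that \<open>K\<close> is built from the kernels of \<open>d\<close> and
  \<open>d'\<close>.\<close>

lemma exact_structure_inj_generated: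
  assumes "additive_category C" and ex: "exact_structure C D" and M: "\<M> \<subseteq> Obj C"
  shows "exact_structure C (inj_generated C D \<M>)" (is "exact_structure C ?F")
proof -
  interpret pre_exact C D using pre_exact_of_exact_structure[OF assms(1,2)] .
  note iff = inj_generated_iff[OF M]
  show ?thesis
  proof (rule pre_exact.exact_structureI[OF pre_exact_inj_generated[OF M]])
    fix i d i' d'
    assume F: "(i, d) \<in> ?F" and Y': "Cod C i' = Dom C d'" and iso: "iso_pairs C (i, d) (i', d')"
      and mor: "i' \<in> Mor C" "d' \<in> Mor C"
    have id: "(i, d) \<in> D" using F iff by blast
    obtain X Y Z where hom: "i \<in> Hom C X Y" "d \<in> Hom C Y Z" using conflation_Hom[OF id] .
    obtain X' Y' Z' where hom': "i' \<in> Hom C X' Y'" "d' \<in> Hom C Y' Z'" 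
      using MorI[OF mor(1)] MorI[OF mor(2), folded Y'] by blast
    obtain a a' b b' c c' where abc: "a \<in> Hom C X X'" "a' \<in> Hom C X' X" "b \<in> Hom C Y Y'"
      "b' \<in> Hom C Y' Y" "c \<in> Hom C Z Z'" "c' \<in> Hom C Z' Z" "a \<cdot>\<^bsub>C\<^esub> a' = Ident C X'"
      "b' \<cdot>\<^bsub>C\<^esub> b = Ident C Y" "c \<cdot>\<^bsub>C\<^esub> c' = Ident C Z'" "b \<cdot>\<^bsub>C\<^esub> i = i' \<cdot>\<^bsub>C\<^esub> a"
      "c \<cdot>\<^bsub>C\<^esub> d = d' \<cdot>\<^bsub>C\<^esub> b"
      using iso_pairs_Hom[OF iso hom hom' category_axioms] .
    have "\<exists>f\<in>Hom C Y' A. f \<cdot>\<^bsub>C\<^esub> i' = g" if A: "A \<in> \<M>" and g: "g \<in> Hom C X' A" for A g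
    proof -
      obtain f where f: "f \<in> Hom C Y A" "f \<cdot>\<^bsub>C\<^esub> i = g \<cdot>\<^bsub>C\<^esub> a"
        using inj_generated_extend[OF M F hom(1) A Comp_closed[OF abc(1) g]] .
      have "b \<cdot>\<^bsub>C\<^esub> (i \<cdot>\<^bsub>C\<^esub> a') = i'"
        using Comp_assoc[OF abc(2) hom(1) abc(3)] Comp_assoc[OF abc(2,1) hom'(1)] abc(7,10)
          Ident_right[OF hom'(1)] by simp
      \<comment> \<open>The commuting square is inverted, so that an extension along
        \<open>i\<close> becomes one along \<open>i'\<close> after composing with
        \<open>b'\<close>.\<close>
      then have "b' \<cdot>\<^bsub>C\<^esub> i' = i \<cdot>\<^bsub>C\<^esub> a'"
        using Comp_assoc[OF Comp_closed[OF abc(2) hom(1)] abc(3,4)] abc(8)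
          Ident_left[OF Comp_closed[OF abc(2) hom(1)]] by simp
      then have "(f \<cdot>\<^bsub>C\<^esub> b') \<cdot>\<^bsub>C\<^esub> i' = g"
        using Comp_assoc[OF hom'(1) abc(4) f(1)] Comp_assoc[OF abc(2) hom(1) f(1)]
          Comp_assoc[OF abc(2,1) g] abc(7) f(2) Ident_right[OF g] by simp
      then show ?thesis using Comp_closed[OF abc(4) f(1)] by blast
    qed
    then show "(i', d') \<in> ?F"
      using iff[of i' d'] exact_structure_iso_closed[OF ex id Y' iso mor] HomD(2,3)[OF hom'(1)] by simp
  next
    fix d d'
    assume "d \<in> deflations ?F" "d' \<in> deflations ?F" and comp: "Cod C d = Dom C d'"
    then obtain i i' where F: "(i, d) \<in> ?F" "(i', d') \<in> ?F" by (auto simp: deflations_def)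
    then have D: "(i, d) \<in> D" "(i', d') \<in> D" using iff by blast+
    then have "d' \<cdot>\<^bsub>C\<^esub> d \<in> deflations D"
      using exact_structure_deflations_comp[OF ex _ _ comp] by (force simp: deflations_def)
    then obtain k where kD: "(k, d' \<cdot>\<^bsub>C\<^esub> d) \<in> D" by (auto simp: deflations_def)
    obtain X Y Z where hom: "i \<in> Hom C X Y" "d \<in> Hom C Y Z" using conflation_Hom[OF D(1)] .
    obtain X' W where hom': "i' \<in> Hom C X' Z" "d' \<in> Hom C Z W"
      using conflation_kernel[OF D(2)] comp HomD(3)[OF hom(2)] unfolding is_kernel_def Hom_def by simp
    note dd = Comp_closed[OF hom(2) hom'(2)]
    obtain K where k: "k \<in> Hom C K Y"
      using conflation_kernel[OF kD] HomD(2)[OF dd] unfolding is_kernel_def Hom_def by simp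
    note ker = conflation_kernel[OF D(1)] and ker' = conflation_kernel[OF D(2)]
      and kerk = conflation_kernel[OF kD]
    note obj = HomD(4)[OF hom(1)] HomD(4)[OF k] HomD(5)[OF hom'(2)]
    have di: "d \<cdot>\<^bsub>C\<^esub> i = Zer C X Z" using ker[unfolded is_kernel_iff[OF hom]] by blast
    have di': "d' \<cdot>\<^bsub>C\<^esub> i' = Zer C X' W" using ker'[unfolded is_kernel_iff[OF hom']] by blast
    have dk: "(d' \<cdot>\<^bsub>C\<^esub> d) \<cdot>\<^bsub>C\<^esub> k = Zer C K W" using kerk[unfolded is_kernel_iff[OF k dd]] by blast
    \<comment> \<open>The kernel of the composite is an extension of the two kernels:
      \<open>v : K \<rightarrow> X'\<close> is the pullback of \<open>d\<close> along \<open>i'\<close>, hence a deflation with kernel \<open>X\<close>.\<close>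
    have "(d' \<cdot>\<^bsub>C\<^esub> d) \<cdot>\<^bsub>C\<^esub> i = Zer C X W"
      using Comp_assoc[OF hom hom'(2)] di Comp_Zer[OF hom'(2) obj(1)] by simp
    then obtain u where u: "u \<in> Hom C X K" "k \<cdot>\<^bsub>C\<^esub> u = i"
      using kernel_lift[OF kerk k dd hom(1)] by blast
    have "d' \<cdot>\<^bsub>C\<^esub> (d \<cdot>\<^bsub>C\<^esub> k) = Zer C K W" using Comp_assoc[OF k hom(2) hom'(2)] dk by simp
    then obtain v where v: "v \<in> Hom C K X'" "i' \<cdot>\<^bsub>C\<^esub> v = d \<cdot>\<^bsub>C\<^esub> k"
      using kernel_lift[OF ker' hom' Comp_closed[OF k hom(2)]] by blast
    have pb: "is_pullback C d i' k v"
      unfolding is_pullback_iff[OF hom(2) hom'(1) k v(1)]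
    proof (intro conjI allI ballI impI)
      show "d \<cdot>\<^bsub>C\<^esub> k = i' \<cdot>\<^bsub>C\<^esub> v" using v(2) by simp
    next
      fix T a b
      assume a: "a \<in> Hom C T Y" and b: "b \<in> Hom C T X'" and ab: "d \<cdot>\<^bsub>C\<^esub> a = i' \<cdot>\<^bsub>C\<^esub> b"
      have "(d' \<cdot>\<^bsub>C\<^esub> d) \<cdot>\<^bsub>C\<^esub> a = Zer C T W"
        using Comp_assoc[OF a hom(2) hom'(2)] Comp_assoc[OF b hom'] ab di' Zer_Comp[OF b obj(3)]
        by simp
      then obtain h where h: "h \<in> Hom C T K" "k \<cdot>\<^bsub>C\<^esub> h = a" using kernel_lift[OF kerk k dd a] by blast
      have "i' \<cdot>\<^bsub>C\<^esub> (v \<cdot>\<^bsub>C\<^esub> h) = i' \<cdot>\<^bsub>C\<^esub> b"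
        using Comp_assoc[OF h(1) v(1) hom'(1)] Comp_assoc[OF h(1) k hom(2)] v(2) h(2) ab by simp
      then have "v \<cdot>\<^bsub>C\<^esub> h = b" by (rule kernel_mono[OF ker' hom' Comp_closed[OF h(1) v(1)] b])
      moreover have "h' = h" if "h' \<in> Hom C T K" "k \<cdot>\<^bsub>C\<^esub> h' = a" for h'
        using kernel_mono[OF kerk k dd that(1) h(1)] that(2) h(2) by simp
      ultimately show "\<exists>!h. h \<in> Hom C T K \<and> k \<cdot>\<^bsub>C\<^esub> h = a \<and> v \<cdot>\<^bsub>C\<^esub> h = b" using h by blast
    qed
    obtain u' where u': "u' \<in> Hom C X K" "k \<cdot>\<^bsub>C\<^esub> u' = i" "(u', v) \<in> D"
      using pullback_conflation[OF D(1) hom pb hom'(1) k v(1)] .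
    \<comment> \<open>The pullback conflation brings its own inflation \<open>u'\<close>; as
      \<open>k\<close> is monic, it is the map \<open>u\<close> constructed before.\<close>
    have "u' = u" using kernel_mono[OF kerk k dd u'(1) u(1)] u'(2) u(2) by simp
    then have uv: "(u, v) \<in> D" using u'(3) by simp
    have "\<exists>f\<in>Hom C Y A. f \<cdot>\<^bsub>C\<^esub> k = g" if A: "A \<in> \<M>" and g: "g \<in> Hom C K A" for A g
    proof -
      note AO = HomD(5)[OF g]
      \<comment> \<open>First approximation: \<open>e\<close> extends only the restriction of
        \<open>g\<close> to \<open>X\<close>. The error \<open>h = g - e \<cdot> k\<close> vanishes
        on \<open>X\<close>, so it factors through the cokernel \<open>v\<close> of \<open>u\<close>
        as \<open>m\<close>, and \<open>m\<close> extends along \<open>i'\<close> to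
        \<open>n\<close>. The corrected extension is \<open>e + n \<cdot> d\<close>.\<close>
      obtain e where e: "e \<in> Hom C Y A" "e \<cdot>\<^bsub>C\<^esub> i = g \<cdot>\<^bsub>C\<^esub> u"
        using inj_generated_extend[OF M F(1) hom(1) A Comp_closed[OF u(1) g]] .
      note ek = Comp_closed[OF k e(1)]
      obtain h where h: "h \<in> Hom C K A" "Plus C (e \<cdot>\<^bsub>C\<^esub> k) h = g" using difference_ex[OF g ek] .
      have "(e \<cdot>\<^bsub>C\<^esub> k) \<cdot>\<^bsub>C\<^esub> u = g \<cdot>\<^bsub>C\<^esub> u" using Comp_assoc[OF u(1) k e(1)] u(2) e(2) by simp
      then have "Plus C (g \<cdot>\<^bsub>C\<^esub> u) (h \<cdot>\<^bsub>C\<^esub> u) = g \<cdot>\<^bsub>C\<^esub> u"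
        using Comp_Plus_left[OF u(1) ek h(1)] h(2) by simp
      then have "h \<cdot>\<^bsub>C\<^esub> u = Zer C X A"
        by (rule Plus_cancel_left[OF Comp_closed[OF u(1) g] Comp_closed[OF u(1) h(1)]])
      then obtain m where m: "m \<in> Hom C X' A" "m \<cdot>\<^bsub>C\<^esub> v = h"
        using cokernel_lift[OF conflation_cokernel[OF uv] u(1) v(1) h(1)] by blast
      obtain n where n: "n \<in> Hom C Z A" "n \<cdot>\<^bsub>C\<^esub> i' = m"
        using inj_generated_extend[OF M F(2) hom'(1) A m(1)] .
      note nd = Comp_closed[OF hom(2) n(1)]
      have "(n \<cdot>\<^bsub>C\<^esub> d) \<cdot>\<^bsub>C\<^esub> k = n \<cdot>\<^bsub>C\<^esub> (i' \<cdot>\<^bsub>C\<^esub> v)" using Comp_assoc[OF k hom(2) n(1)] v(2) by simp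
      also have "\<dots> = h" using Comp_assoc[OF v(1) hom'(1) n(1)] n(2) m(2) by simp
      finally have "(n \<cdot>\<^bsub>C\<^esub> d) \<cdot>\<^bsub>C\<^esub> k = h" .
      then have "Plus C e (n \<cdot>\<^bsub>C\<^esub> d) \<cdot>\<^bsub>C\<^esub> k = g" using Comp_Plus_left[OF k e(1) nd] h(2) by simp
      then show ?thesis using Plus_closed[OF e(1) nd] by blast
    qed
    then have "(k, d' \<cdot>\<^bsub>C\<^esub> d) \<in> ?F"
      using iff[of k "d' \<cdot>\<^bsub>C\<^esub> d"] kD HomD(2,3)[OF k] by simp
    then show "d' \<cdot>\<^bsub>C\<^esub> d \<in> deflations ?F" by (force simp: deflations_def)
  qed
qed

text \<open>The usual triangle identity of a Galois connection;
  \<open>\<M> \<subseteq> Obj C\<close> ensures that \<open>\<M>\<close> lies in its double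
  orthogonal.\<close>

lemma right_perp_left_perp_right_perp:
  "\<M> \<subseteq> Obj C \<Longrightarrow> right_perp C D (left_perp C D (right_perp C D \<M>)) = right_perp C D \<M>"
  by (auto simp: right_perp_def left_perp_def)

lemma left_perp_right_perp_left_perp:
  "\<M> \<subseteq> Obj C \<Longrightarrow> left_perp C D (right_perp C D (left_perp C D \<M>)) = left_perp C D \<M>"
  by (auto simp: right_perp_def left_perp_def)

theorem proposition3p6:
  fixes C :: "('o, 'm, 'x) preadditive_data_scheme"
    and D :: "('m \<times> 'm) set"
  assumes "additive_category C"
    and "exact_structure C D"
  shows "(Psi C D ` DPEx C D = DCot C D \<and>
          (\<forall>(\<A>, \<B>)\<in>DCot C D. proj_generated C D \<A> \<in> DPEx C D \<and>
            \<B> = Div C D (proj_generated C D \<A>)))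
       \<and> (Phi C D ` DIEx C D = DCot C D \<and>
          (\<forall>(\<A>, \<B>)\<in>DCot C D. inj_generated C D \<B> \<in> DIEx C D \<and>
            \<A> = Flat C D (inj_generated C D \<B>)))"
proof -
  interpret pre_exact C D using pre_exact_of_exact_structure[OF assms] .
  have proj: "proj_generated C D \<A> \<in> DPEx C D" "Div C D (proj_generated C D \<A>) = \<B>"
    "Psi C D (proj_generated C D \<A>) = (\<A>, \<B>)" if "(\<A>, \<B>) \<in> DCot C D" for \<A> \<B>
    using that exact_structure_proj_generated[OF assms, of \<A>] Div_proj_generated[of \<A>]
    by (auto simp: DCot_def DPEx_def Psi_def)
  have inj: "inj_generated C D \<B> \<in> DIEx C D" "Flat C D (inj_generated C D \<B>) = \<A>"
    "Phi C D (inj_generated C D \<B>) = (\<A>, \<B>)" if "(\<A>, \<B>) \<in> DCot C D" for \<A> \<B>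
    using that exact_structure_inj_generated[OF assms, of \<B>] Flat_inj_generated[of \<B>]
    by (auto simp: DCot_def DIEx_def Phi_def)
  have perp_Obj: "right_perp C D \<M> \<subseteq> Obj C" "left_perp C D \<M> \<subseteq> Obj C" for \<M>
    by (auto simp: right_perp_def left_perp_def)
  \<comment> \<open>Being generated by some \<open>\<M>\<close>, \<open>E\<close> has the right
    orthogonal of \<open>\<M>\<close> as its class of divisible objects, and such a class is closed
    under the double orthogonal.\<close>
  have Psi: "Psi C D E \<in> DCot C D" if E: "E \<in> DPEx C D" for E
  proof -
    obtain \<M> where M: "\<M> \<subseteq> Obj C" "E = proj_generated C D \<M>" using E by (auto simp: DPEx_def)
    then show ?thesis
      using Div_proj_generated[OF M(1)] right_perp_left_perp_right_perp[OF M(1), of D] perp_Obj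
      by (simp add: DCot_def Psi_def)
  qed
  have Phi: "Phi C D E \<in> DCot C D" if E: "E \<in> DIEx C D" for E
  proof -
    obtain \<M> where M: "\<M> \<subseteq> Obj C" "E = inj_generated C D \<M>" using E by (auto simp: DIEx_def)
    then show ?thesis
      using Flat_inj_generated[OF M(1)] left_perp_right_perp_left_perp[OF M(1), of D] perp_Obj
      by (simp add: DCot_def Phi_def)
  qed
  have "Psi C D ` DPEx C D = DCot C D"
  proof (intro equalityI image_subsetI subsetI)
    fix P assume P: "P \<in> DCot C D"
    obtain \<A> \<B> where AB: "P = (\<A>, \<B>)" by fastforce
    show "P \<in> Psi C D ` DPEx C D"
      \<comment> \<open>The preimage of the pair is the structure projectively generated by its own
        left half.\<close>
      using imageI[OF proj(1), of \<A> \<B> "Psi C D"] proj(3)[of \<A> \<B>] P AB by simp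
  qed (fact Psi)
  moreover have "Phi C D ` DIEx C D = DCot C D"
  proof (intro equalityI image_subsetI subsetI)
    fix P assume P: "P \<in> DCot C D"
    obtain \<A> \<B> where AB: "P = (\<A>, \<B>)" by fastforce
    show "P \<in> Phi C D ` DIEx C D"
      using imageI[OF inj(1), of \<A> \<B> "Phi C D"] inj(3)[of \<A> \<B>] P AB by simp
  qed (fact Phi)
  moreover have "\<forall>(\<A>, \<B>)\<in>DCot C D. proj_generated C D \<A> \<in> DPEx C D \<and>
      \<B> = Div C D (proj_generated C D \<A>)"
    using proj(1) proj(2)[symmetric] by fast
  moreover have "\<forall>(\<A>, \<B>)\<in>DCot C D. inj_generated C D \<B> \<in> DIEx C D \<and>
      \<A> = Flat C D (inj_generated C D \<B>)"
    using inj(1) inj(2)[symmetric] by fast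
  ultimately show ?thesis by simp
qed

end
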